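(* Let $d\ge 1$. Every TC-convex set $G\subseteq\mathbb{T}_{\pm}^d$ is an intersection of TC-hemispaces. More precisely, each of these TC-hemispaces can be chosen such that its complement in $\mathbb{T}_{\pm}^d$ is TO-convex.
   Context: Signed tropical numbers. Let $\mathbb{O}=-\infty$ be the tropical zero. $\mathbb{T}_{>\mathbb{O}}=\mathbb{R}$ (positive numbers), $\mathbb{T}_{<\mathbb{O}}=\{\ominus r: r\in\mathbb{R}\}$ (negative numbers), $\mathbb{T}_{\ge\mathbb{O}}=\mathbb{R}\cup\{\mathbb{O}\}$, $\mathbb{T}_{\pm}=\mathbb{T}_{>\mathbb{O}}\cup\mathbb{T}_{<\mathbb{O}}\cup\{\mathbb{O}\}$, balanced numbers $\mathbb{T}_{\bullet}=\{\bullet r: r\in\mathbb{R}\}\cup\{\mathbb{O}\}$, symmetrized semiring $\mathbb{S}=\mathbb{T}_{\pm}\cup\mathbb{T}_{\bullet}$. The norm is $|r|=|\ominus r|=|\bullet r|=r$ and $|\mathbb{O}|=\mathbb{O}$; the sign $\mathrm{tsgn}$ takes values in $\{\oplus,\ominus,\bullet,\mathbb{O}\}$. Addition on $\mathbb{S}$: $x\oplus y$ equals $x$ if $|x|>|y|$, $y$ if $|y|>|x|$, $x$ if $|x|=|y|$ and $\mathrm{tsgn}(x)=\mathrm{tsgn}(y)$, and $\bullet|x|$ if $|x|=|y|$ and the signs differ. Multiplication: $x\odot y$ has norm $|x|+|y|$ and sign the product of signs (with $\oplus,\ominus,\bullet$ multiplying like $1,-1,0$); $\mathbb{O}$ is absorbing.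 The multiplicative unit is the real number $0$. Operations extend to vectors and matrices in the usual way. Order on $\mathbb{T}_{\pm}$: $x>y$ iff $x\oplus(\ominus y)\in\mathbb{T}_{>\mathbb{O}}$ (a total order). Closed halfspaces. For $a=(a_0,\dots,a_d)\in\mathbb{T}_{\pm}^{d+1}$ with $(a_1,\dots,a_d)\ne(\mathbb{O},\dots,\mathbb{O})$, $\overline{\mathcal{H}}^+(a)=\{x\in\mathbb{T}_{\pm}^d: a_0\oplus a_1\odot x_1\oplus\dots\oplus a_d\odot x_d\in\mathbb{T}_{>\mathbb{O}}\cup\mathbb{T}_{\bullet}\}$. TC-convexity. For $x,y\in\mathbb{T}_{\pm}^d$, $\mathrm{conv}_{TC}(x,y)$ is the intersection of all closed halfspaces $\overline{\mathcal{H}}^+(a)$ containing both $x$ and $y$. A set $X\subseteq\mathbb{T}_{\pm}^d$ is TC-convex if $\mathrm{conv}_{TC}(x,y)\subseteq X$ for all $x,y\in X$. A TC-hemispace is a TC-convex set $X\subseteq\mathbb{T}_{\pm}^d$ whose complement $\mathbb{T}_{\pm}^d\setminus X$ is also TC-convex. TO-convexity. For $s\in\mathbb{S}$, $\mathcal{U}(s)=\{x\in\mathbb{T}_{\pm}:\ominus|s|\le x\le|s|\}$ if $s\in\mathbb{T}_{\bullet}$ and $\mathcal{U}(s)=\{s\}$ otherwise; for vectors $\mathcal{U}(s)=\prod_i\mathcal{U}(s_i)$. For a finite set $T=\{v_1,\dots,v_n\}\subseteq\mathbb{T}_{\pm}^d$, $\mathrm{conv}_{TO}(T)=\bigcup\{\mathcal{U}(\lambda_1\odot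 v_1\oplus\dots\oplus\lambda_n\odot v_n):\lambda_i\in\mathbb{T}_{\ge\mathbb{O}},\ \bigoplus_i\lambda_i=0\}$. A set $M\subseteq\mathbb{T}_{\pm}^d$ is TO-convex if $\mathrm{conv}_{TO}(T)\subseteq M$ for all finite $T\subseteq M$. *)

theory Defs
  imports "HOL-Analysis.Finite_Cartesian_Product"
begin

section \<open>The symmetrized tropical semiring\<close>

datatype tsign = Plus | Minus | Bullet

fun tsign_mult :: "tsign \<Rightarrow> tsign \<Rightarrow> tsign" where
  "tsign_mult Bullet t = Bullet"
| "tsign_mult s Bullet = Bullet"
| "tsign_mult Plus t = t"
| "tsign_mult s Plus = s"
| "tsign_mult Minus Minus = Plus"

text \<open>
  \<open>Elt Plus r\<close>, \<open>Elt Minus r\<close> and \<open>Elt Bullet r\<close> are the positive number \<open>r\<close>, the negative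
  number \<open>\<ominus> r\<close> and the balanced number \<open>\<bullet> r\<close>; \<open>TZero\<close> is the tropical zero \<open>-\<infinity>\<close>.
  The class operations \<open>+\<close>, \<open>*\<close>, \<open>0\<close>, \<open>1\<close> on this type are the tropical ones, so \<open>0\<close> stands
  for \<open>-\<infinity>\<close> and \<open>1\<close> for the real number zero.
\<close>

datatype symtrop = TZero | Elt tsign real

instantiation symtrop :: "{zero, one, plus, times}"
begin

definition zero_symtrop :: symtrop where
  "zero_symtrop = TZero"

definition one_symtrop :: symtrop where
  "one_symtrop = Elt Plus 0"

fun plus_symtrop :: "symtrop \<Rightarrow> symtrop \<Rightarrow> symtrop" where
  "plus_symtrop TZero y = y"
| "plus_symtrop x TZero = x"
| "plus_symtrop (Elt s r) (Elt t q) =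
     (if r > q then Elt s r
      else if q > r then Elt t q
      else if s = t then Elt s r
      else Elt Bullet r)"

fun times_symtrop :: "symtrop \<Rightarrow> symtrop \<Rightarrow> symtrop" where
  "times_symtrop TZero y = TZero"
| "times_symtrop x TZero = TZero"
| "times_symtrop (Elt s r) (Elt t q) = Elt (tsign_mult s t) (r + q)"

instance ..

end

lemma tsign_mult_commute: "tsign_mult s t = tsign_mult t s"
  by (cases s; cases t; simp)

lemma tsign_mult_assoc: "tsign_mult (tsign_mult s t) u = tsign_mult s (tsign_mult t u)"
  by (cases s; cases t; cases u; simp)

lemma tsign_mult_Plus [simp]: "tsign_mult Plus t = t"
  by (cases t) simp_all

instance symtrop :: comm_semiring_1
proof
  fix a b c :: symtrop
  show "a + b + c = a + (b + c)"
    by (cases a; cases b; cases c) auto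
  show "a + b = b + a"
    by (cases a; cases b) auto
  show "0 + a = a"
    by (simp add: zero_symtrop_def)
  show "a * b * c = a * (b * c)"
    by (cases a; cases b; cases c) (auto simp: tsign_mult_assoc)
  show "a * b = b * a"
    by (cases a; cases b) (auto simp: tsign_mult_commute)
  show "1 * a = a"
    by (cases a) (auto simp: one_symtrop_def)
  show "0 * a = 0" "a * 0 = 0"
    by (cases a; simp add: zero_symtrop_def)+
  show "(0::symtrop) \<noteq> 1"
    by (simp add: zero_symtrop_def one_symtrop_def)
  show "(a + b) * c = a * c + b * c"
  proof (cases c)
    case TZero
    then show ?thesis by (cases a; cases b) auto
  next
    case (Elt u p)
    then show ?thesis
      by (cases u; cases a; cases b) (auto elim!: tsign_mult.elims)
  qed
qed

text \<open>The norm, taken as an element of \<open>\<real> \<union> {-\<infinity>}\<close> inside the semiring.\<close>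

fun tnorm :: "symtrop \<Rightarrow> symtrop" where
  "tnorm TZero = TZero"
| "tnorm (Elt s r) = Elt Plus r"

fun tneg :: "symtrop \<Rightarrow> symtrop" where
  "tneg TZero = TZero"
| "tneg (Elt s r) = Elt (tsign_mult Minus s) r"

definition T_pos :: "symtrop set" where
  "T_pos = range (Elt Plus)"

definition T_neg :: "symtrop set" where
  "T_neg = range (Elt Minus)"

definition T_nonneg :: "symtrop set" where
  "T_nonneg = T_pos \<union> {0}"

definition T_pm :: "symtrop set" where
  "T_pm = T_pos \<union> T_neg \<union> {0}"

definition T_bal :: "symtrop set" where
  "T_bal = range (Elt Bullet) \<union> {0}"

text \<open>Meaningful, and total, only on \<^const>\<open>T_pm\<close>; \<open>tless y x\<close> reads \<open>y < x\<close>.\<close>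

definition tless :: "symtrop \<Rightarrow> symtrop \<Rightarrow> bool" where
  "tless y x \<longleftrightarrow> x + tneg y \<in> T_pos"

definition tle :: "symtrop \<Rightarrow> symtrop \<Rightarrow> bool" where
  "tle y x \<longleftrightarrow> tless y x \<or> y = x"

definition T_space :: "(symtrop ^ 'd) set" where
  "T_space = {x. \<forall>i. x $ i \<in> T_pm}"


section \<open>TC-convexity\<close>

definition closed_halfspace :: "symtrop \<Rightarrow> symtrop ^ 'd \<Rightarrow> (symtrop ^ 'd) set" where
  "closed_halfspace a0 a =
     {x \<in> T_space. a0 + (\<Sum>i\<in>UNIV. a $ i * x $ i) \<in> T_pos \<union> T_bal}"

definition is_closed_halfspace :: "(symtrop ^ 'd) set \<Rightarrow> bool" where
  "is_closed_halfspace H \<longleftrightarrow>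
     (\<exists>a0\<in>T_pm. \<exists>a\<in>T_space. a \<noteq> 0 \<and> H = closed_halfspace a0 a)"

text \<open>
  The family intersected here is never empty: for fixed \<open>a\<close>, every sufficiently large positive
  \<open>a0\<close> gives a halfspace containing both points.
\<close>

definition conv_TC :: "symtrop ^ 'd \<Rightarrow> symtrop ^ 'd \<Rightarrow> (symtrop ^ 'd) set" where
  "conv_TC x y = \<Inter>{H. is_closed_halfspace H \<and> x \<in> H \<and> y \<in> H}"

definition TC_convex :: "(symtrop ^ 'd) set \<Rightarrow> bool" where
  "TC_convex X \<longleftrightarrow> X \<subseteq> T_space \<and> (\<forall>x\<in>X. \<forall>y\<in>X. conv_TC x y \<subseteq> X)"

definition TC_hemispace :: "(symtrop ^ 'd) set \<Rightarrow> bool" where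
  "TC_hemispace X \<longleftrightarrow> TC_convex X \<and> TC_convex (T_space - X)"


section \<open>TO-convexity\<close>

definition \<U> :: "symtrop \<Rightarrow> symtrop set" where
  "\<U> s = (if s \<in> T_bal then {x \<in> T_pm. tle (tneg (tnorm s)) x \<and> tle x (tnorm s)} else {s})"

definition \<U>_vec :: "symtrop ^ 'd \<Rightarrow> (symtrop ^ 'd) set" where
  "\<U>_vec s = {x. \<forall>i. x $ i \<in> \<U> (s $ i)}"

definition conv_TO :: "(symtrop ^ 'd) set \<Rightarrow> (symtrop ^ 'd) set" where
  "conv_TO T = \<Union>{\<U>_vec (\<Sum>v\<in>T. l v *s v) | l. (\<forall>v\<in>T. l v \<in> T_nonneg) \<and> (\<Sum>v\<in>T. l v) = 1}"

definition TO_convex :: "(symtrop ^ 'd) set \<Rightarrow> bool" where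
  "TO_convex M \<longleftrightarrow> M \<subseteq> T_space \<and> (\<forall>T. finite T \<and> T \<subseteq> M \<longrightarrow> conv_TO T \<subseteq> M)"

end

theory Submission
  imports Defs
begin

text \<open>
  The key fact is a Farkas lemma: if \<open>H\<close> is TC-convex, \<open>F \<subseteq> H\<close> is finite and \<open>x \<notin> H\<close>, then some closed
  halfspace contains \<open>F\<close> but not \<open>x\<close>. For coefficients restricted to an orthant this is proved by
  eliminating one coefficient after the other; it yields, for every sign pattern, an element of
  the cone over \<open>H\<close> which lies on prescribed sides of \<open>x\<close>, and these elements are combined into \<open>x\<close> by
  left sums and by eliminations of single cancelling coordinates, which stay within TC-segments.

  By Zorn's lemma let \<open>H\<close> be maximal among the TC-convex sets containing \<open>G\<close> but not \<open>x\<close>. The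
  finitary hull by closed halfspaces is TC-convex, so by maximality every \<open>p \<notin> H\<close> has a finite subset
  of \<open>H \<union> {p}\<close> such that every closed halfspace containing it contains \<open>x\<close>. Given finitely many points
  outside \<open>H\<close> and \<open>q \<in> H\<close>, the Farkas lemma then gives a closed halfspace that contains \<open>q\<close>, but none
  of these points. As the complement of a closed halfspace is TO-convex and closed under
  TC-segments, \<open>q\<close> is in no hull of points outside \<open>H\<close>.
\<close>

section \<open>A Farkas lemma in the nonnegative orthant\<close>

text \<open>
  Signed tropical numbers are represented by reals through \<open>r \<mapsto> exp r\<close>, \<open>\<ominus> r \<mapsto> - exp r\<close>.
  On reals, \<open>left_add x y\<close> is the tropical sum with a cancellation decided in favour of the left operand.
\<close>

definition left_add :: "real \<Rightarrow> real \<Rightarrow> real" where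
  "left_add x y = (if \<bar>y\<bar> \<le> \<bar>x\<bar> then x else y)"

text \<open>
  The tropical sum of all \<open>t i\<close> is positive or balanced.
\<close>

definition tropical_nonneg :: "('e \<Rightarrow> real) \<Rightarrow> bool" where
  "tropical_nonneg t \<longleftrightarrow> (\<forall>i. \<exists>k. - t i \<le> t k)"

definition left_cone :: "('e \<Rightarrow> real) set \<Rightarrow> bool" where
  "left_cone W \<longleftrightarrow> (\<forall>u\<in>W. \<forall>c>0. (\<lambda>i. c * u i) \<in> W) \<and> (\<forall>u\<in>W. \<forall>v\<in>W. (\<lambda>i. left_add (u i) (v i)) \<in> W)"

text \<open>The upward closure. For nonnegative coefficients, enlarging a vector weakens the
  condition it imposes, so elimination can be carried out up to enlargement.\<close>

definition above :: "('e \<Rightarrow> real) set \<Rightarrow> ('e \<Rightarrow> real) set" where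
  "above W = {z. \<exists>u\<in>W. \<forall>i. u i \<le> z i}"

definition entails :: "('e \<Rightarrow> real) set \<Rightarrow> ('e \<Rightarrow> real) \<Rightarrow> bool" where
  "entails F x \<longleftrightarrow>
    (\<forall>a. (\<forall>i. 0 \<le> a i) \<longrightarrow> (\<forall>f\<in>F. tropical_nonneg (\<lambda>i. a i * f i)) \<longrightarrow> tropical_nonneg (\<lambda>i. a i * x i))"

lemma left_add_mono: "x \<le> x' \<Longrightarrow> y \<le> y' \<Longrightarrow> left_add x y \<le> left_add x' y'"
  unfolding left_add_def by auto

lemma not_tropical_nonneg: "\<not> tropical_nonneg t \<longleftrightarrow> (\<exists>i. \<forall>k. t k < - t i)"
  unfolding tropical_nonneg_def by (auto simp: not_le)

lemma tropical_nonnegI: "(\<And>i. t i < 0 \<Longrightarrow> \<exists>k. - t i \<le> t k) \<Longrightarrow> tropical_nonneg t"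
  unfolding tropical_nonneg_def by (metis linorder_not_le neg_le_0_iff_le order_trans)

lemma tropical_nonnegD: "tropical_nonneg t \<Longrightarrow> \<exists>k. - t i \<le> t k"
  unfolding tropical_nonneg_def by auto

text \<open>A negative term of the maximum comes from \<open>a\<close> or \<open>b\<close>; the term
  dominating it there is positive, so passing to the larger coefficient only increases it.\<close>

lemma tropical_nonneg_max:
  assumes "tropical_nonneg (\<lambda>i. a i * x i)" "tropical_nonneg (\<lambda>i. b i * x i)" "\<And>i. 0 \<le> a i" "\<And>i. 0 \<le> b i"
  shows "tropical_nonneg (\<lambda>i. max (a i) (b i) * x i)"
proof (rule tropical_nonnegI)
  fix i assume neg: "max (a i) (b i) * x i < 0"
  obtain k l where k: "- (a i * x i) \<le> a k * x k" and l: "- (b i * x i) \<le> b l * x l"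
    using assms(1,2) unfolding tropical_nonneg_def by blast
  have "x i < 0" using neg assms(3)[of i] assms(4)[of i]
    by (metis linorder_not_le max.coboundedI1 mult_nonneg_nonneg)
  show "\<exists>k. - (max (a i) (b i) * x i) \<le> max (a k) (b k) * x k"
  proof (cases "a i \<le> b i")
    case True
    then have "0 < b i" using neg assms(4)[of i] by (auto simp: max_def mult_less_0_iff)
    then have "0 < b l * x l" using l \<open>x i < 0\<close> by (smt (verit) mult_pos_neg)
    then have "0 < x l" using assms(4)[of l] by (simp add: zero_less_mult_iff)
    then have "b l * x l \<le> max (a l) (b l) * x l" by (simp add: mult_right_mono)
    then have "- (b i * x i) \<le> max (a l) (b l) * x l" using l by linarith
    then show ?thesis using True by (intro exI[of _ l]) (simp add: max.absorb2)
  next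
    case False
    then have "0 < a i" using assms(4)[of i] by simp
    then have "0 < a k * x k" using k \<open>x i < 0\<close> by (smt (verit) mult_pos_neg)
    then have "0 < x k" using assms(3)[of k] by (simp add: zero_less_mult_iff)
    then have "a k * x k \<le> max (a k) (b k) * x k" by (simp add: mult_right_mono)
    then show ?thesis using False k by (intro exI[of _ k]) (auto simp: max_def)
  qed
qed

text \<open>Of the two violating negative terms, the larger in absolute value survives: its
  coefficient only grows, and it exceeds the positive terms of both systems.\<close>

lemma not_tropical_nonneg_max:
  assumes "\<not> tropical_nonneg (\<lambda>i. a i * x i)" "\<not> tropical_nonneg (\<lambda>i. b i * x i)" "\<And>i. 0 \<le> a i" "\<And>i. 0 \<le> b i"
  shows "\<not> tropical_nonneg (\<lambda>i. max (a i) (b i) * x i)"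
proof -
  obtain i j where i: "\<And>k. a k * x k < - (a i * x i)" and j: "\<And>k. b k * x k < - (b j * x j)"
    using assms(1,2) unfolding not_tropical_nonneg by blast
  have *: "max (a k) (b k) * x k < max (- (a i * x i)) (- (b j * x j))" for k
    using i[of k] j[of k] by (auto simp: max_def)
  have xi: "x i < 0" and xj: "x j < 0"
    using i[of i] j[of j] assms(3)[of i] assms(4)[of j] by (auto simp: mult_less_0_iff)
  have "- (a i * x i) \<le> - (max (a i) (b i) * x i)" "- (b j * x j) \<le> - (max (a j) (b j) * x j)"
    using xi xj by (auto intro: mult_right_mono_neg)
  then show ?thesis unfolding not_tropical_nonneg using *
    by (metis (no_types, lifting) max_def order_less_le_trans)
qed

lemma tropical_nonneg_scale:
  assumes "0 < c" shows "tropical_nonneg (\<lambda>i. (c * a i) * x i) \<longleftrightarrow> tropical_nonneg (\<lambda>i. a i * x i)"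
proof -
  have "(- (c * a i * x i) \<le> c * a k * x k) \<longleftrightarrow> (- (a i * x i) \<le> a k * x k)" for i k
    using mult_le_cancel_left_pos[OF assms, of "- (a i * x i)" "a k * x k"] by (simp add: mult.assoc)
  then show ?thesis unfolding tropical_nonneg_def by simp
qed

lemma tropical_nonneg_upd_zero:
  assumes "a j = 0" shows "tropical_nonneg (\<lambda>i. a i * (g(j := 0)) i) \<longleftrightarrow> tropical_nonneg (\<lambda>i. a i * g i)"
proof -
  have "(\<lambda>i. a i * (g(j := 0)) i) = (\<lambda>i. a i * g i)" using assms by auto
  then show ?thesis by simp
qed

text \<open>Only \<open>b\<close> has to respect the entry of \<open>g\<close> at \<open>j\<close>:
  a coordinate where \<open>a\<close> is larger differs from \<open>j\<close>, and the positive term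
  dominating it for \<open>g(j := 0)\<close> cannot sit at \<open>j\<close> either.\<close>

lemma tropical_nonneg_join:
  assumes "tropical_nonneg (\<lambda>i. a i * (g(j := 0)) i)" "tropical_nonneg (\<lambda>i. b i * g i)" "a j = b j"
    "\<And>i. 0 \<le> a i" "\<And>i. 0 \<le> b i"
  shows "tropical_nonneg (\<lambda>i. max (a i) (b i) * g i)"
proof (rule tropical_nonnegI)
  fix i assume neg: "max (a i) (b i) * g i < 0"
  have gi: "g i < 0" using neg assms(4)[of i] assms(5)[of i]
    by (metis linorder_not_le max.coboundedI1 mult_nonneg_nonneg)
  have up: "b l * g l \<le> max (a l) (b l) * g l" "a l * g l \<le> max (a l) (b l) * g l" if "0 < g l" for l
    using that by (auto simp: mult_right_mono)
  show "\<exists>k. - (max (a i) (b i) * g i) \<le> max (a k) (b k) * g k"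
  proof (cases "a i \<le> b i")
    case True
    obtain l where l: "- (b i * g i) \<le> b l * g l" using tropical_nonnegD[OF assms(2)] by blast
    have "0 < b i" using neg True assms(5)[of i] by (auto simp: max_def mult_less_0_iff)
    then have "0 < b l * g l" using l gi by (smt (verit) mult_pos_neg)
    then have "0 < g l" using assms(5)[of l] by (simp add: zero_less_mult_iff)
    then have "- (b i * g i) \<le> max (a l) (b l) * g l" using l up(1)[of l] by linarith
    then show ?thesis using True by (intro exI[of _ l]) (simp add: max.absorb2)
  next
    case False
    then have ij: "i \<noteq> j" using assms(3) by auto
    obtain l where l: "- (a i * g i) \<le> a l * (g(j := 0)) l" using tropical_nonnegD[OF assms(1), of i] ij by auto
    have "0 < a i" using False assms(5)[of i] by simp
    then have p: "0 < a l * (g(j := 0)) l" using l gi by (smt (verit) mult_pos_neg)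
    then have "l \<noteq> j" by auto
    with p have "0 < g l" using assms(4)[of l] by (simp add: zero_less_mult_iff)
    have "- (a i * g i) \<le> a l * g l" using l \<open>l \<noteq> j\<close> by simp
    then have "- (a i * g i) \<le> max (a l) (b l) * g l" using up(2)[OF \<open>0 < g l\<close>] by (rule order_trans)
    then show ?thesis using False by (intro exI[of _ l]) (simp add: max.absorb1)
  qed
qed

text \<open>
  The solutions of a tropical system in the nonnegative orthant are closed under maxima and scaling.
  So if weakening \<open>g\<close>, respectively \<open>h\<close>, at \<open>j\<close> destroyed the entailment, the maximum of the two
  counterexamples, scaled to agree at \<open>j\<close>, would be a counterexample for \<open>F\<close>.
\<close>

lemma entails_split:
  assumes "entails F x" "g \<in> F" "h \<in> F" "g \<noteq> h"
  shows "entails (insert (g(j := 0)) (F - {g})) x \<or> entails (insert (h(j := 0)) (F - {h})) x"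
proof (rule ccontr)
  assume "\<not> ?thesis"
  then obtain a b where a: "\<And>i. 0 \<le> a i" "\<And>f. f \<in> F - {g} \<Longrightarrow> tropical_nonneg (\<lambda>i. a i * f i)"
      "tropical_nonneg (\<lambda>i. a i * (g(j := 0)) i)" "\<not> tropical_nonneg (\<lambda>i. a i * x i)"
    and b: "\<And>i. 0 \<le> b i" "\<And>f. f \<in> F - {h} \<Longrightarrow> tropical_nonneg (\<lambda>i. b i * f i)"
      "tropical_nonneg (\<lambda>i. b i * (h(j := 0)) i)" "\<not> tropical_nonneg (\<lambda>i. b i * x i)"
    unfolding entails_def by (simp del: fun_upd_apply) (elim conjE exE, blast)
  have E: "\<exists>f\<in>F. \<not> tropical_nonneg (\<lambda>i. c i * f i)" if "\<And>i. 0 \<le> c i" "\<not> tropical_nonneg (\<lambda>i. c i * x i)" for c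
    using assms(1) that unfolding entails_def by blast
  \<comment> \<open>With \<open>a j = 0\<close>, the vectors \<open>g\<close> and
    \<open>g(j := 0)\<close> impose the same condition on \<open>a\<close>, which would then satisfy
    all of \<open>F\<close>.\<close>
  have "a j \<noteq> 0" using E[of a] a tropical_nonneg_upd_zero[of a j g] by blast
  moreover have "b j \<noteq> 0" using E[of b] b tropical_nonneg_upd_zero[of b j h] by blast
  ultimately have pos: "0 < a j" "0 < b j" using a(1)[of j] b(1)[of j] by auto
  define c where "c = a j / b j"
  have c: "0 < c" "c * b j = a j" using pos by (auto simp: c_def)
  define b' where "b' = (\<lambda>i. c * b i)"
  have b': "\<And>i. 0 \<le> b' i" "\<And>f. f \<in> F - {h} \<Longrightarrow> tropical_nonneg (\<lambda>i. b' i * f i)"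
      "tropical_nonneg (\<lambda>i. b' i * (h(j := 0)) i)" "\<not> tropical_nonneg (\<lambda>i. b' i * x i)" "b' j = a j"
    using b c tropical_nonneg_scale[OF c(1), of b] unfolding b'_def by auto
  have "tropical_nonneg (\<lambda>i. max (a i) (b' i) * f i)" if "f \<in> F" for f
  proof -
    consider "f = g" | "f = h" | "f \<noteq> g" "f \<noteq> h" by blast
    then show ?thesis
    proof cases
      case 1
      then show ?thesis using tropical_nonneg_join[of a g j b'] a b' assms(3,4) that by auto
    next
      case 2
      then show ?thesis using tropical_nonneg_join[of b' h j a] a b' assms(3,4) that by (auto simp: max.commute)
    next
      case 3
      then show ?thesis using tropical_nonneg_max[of a f b'] a b' that by auto
    qed
  qed
  moreover have "0 \<le> max (a i) (b' i)" for i using a(1)[of i] by simp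
  ultimately show False
    using E[of "\<lambda>i. max (a i) (b' i)"] not_tropical_nonneg_max[OF a(4) b'(4) a(1) b'(1)] by blast
qed

text \<open>Each use of \<open>entails_split\<close> zeroes one negative entry at \<open>j\<close>,
  so the number of such entries drops. The set \<open>X\<close> is an invariant preserved by this
  zeroing.\<close>

lemma entails_unique:
  assumes "finite F" "F \<subseteq> X" "entails F x" "\<And>f. f \<in> X \<Longrightarrow> f j < 0 \<Longrightarrow> f(j := 0) \<in> X"
  shows "\<exists>F'. finite F' \<and> F' \<subseteq> X \<and> entails F' x \<and> (\<forall>g\<in>F'. \<forall>h\<in>F'. g j < 0 \<longrightarrow> h j < 0 \<longrightarrow> g = h)"
  using assms(1-3)
proof (induction "card {f\<in>F. f j < 0}" arbitrary: F rule: less_induct)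
  case less
  show ?case
  proof (cases "\<forall>g\<in>F. \<forall>h\<in>F. g j < 0 \<longrightarrow> h j < 0 \<longrightarrow> g = h")
    case True
    then show ?thesis using less.prems by blast
  next
    case False
    then obtain g h where gh: "g \<in> F" "h \<in> F" "g j < 0" "h j < 0" "g \<noteq> h" by blast
    have *: "card {f \<in> insert (k(j := 0)) (F - {k}). f j < 0} < card {f\<in>F. f j < 0}"
      if "k \<in> F" "k j < 0" for k
    proof (rule psubset_card_mono)
      show "finite {f\<in>F. f j < 0}" using less.prems(1) by simp
      have "k \<notin> {f \<in> insert (k(j := 0)) (F - {k}). f j < 0}" by (auto simp: fun_eq_iff)
      then show "{f \<in> insert (k(j := 0)) (F - {k}). f j < 0} \<subset> {f\<in>F. f j < 0}"
        using that by auto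
    qed
    show ?thesis
      using entails_split[OF less.prems(3) gh(1,2,5), of j]
    proof
      assume "entails (insert (g(j := 0)) (F - {g})) x"
      then show ?thesis using less.hyps[OF *[OF gh(1,3)]] less.prems gh assms(4)[of g]
        by (auto simp del: fun_upd_apply)
    next
      assume "entails (insert (h(j := 0)) (F - {h})) x"
      then show ?thesis using less.hyps[OF *[OF gh(2,4)]] less.prems gh assms(4)[of h]
        by (auto simp del: fun_upd_apply)
    qed
  qed
qed

text \<open>
  As \<open>g\<close> is the only upper bound for the unknown \<open>a j\<close> and all other constraints, as well as a
  violation at \<open>x\<close>, profit from a large \<open>a j\<close>, it may be replaced by its bound \<open>max\<^sub>i a i * q i\<close>.
\<close>

lemma entails_elim:
  fixes x g :: "'e::finite \<Rightarrow> real"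
  assumes ent: "entails F x" and g: "g \<in> F" "g j < 0" and xj: "x j < 0"
    and uniq: "\<And>f. f \<in> F \<Longrightarrow> f j < 0 \<Longrightarrow> f = g"
  defines "q \<equiv> \<lambda>i. max (g i) 0 / (- g j)"
  shows "entails ((\<lambda>f. (\<lambda>i. left_add (max (f j) 0 * q i) (f i))(j := 0)) ` F) ((\<lambda>i. left_add (x i) (x j * q i))(j := 0))"
  unfolding entails_def
proof (intro allI impI)
  fix a :: "'e \<Rightarrow> real"
  assume a0: "\<forall>i. 0 \<le> a i"
    and aF: "\<forall>f\<in>(\<lambda>f. (\<lambda>i. left_add (max (f j) 0 * q i) (f i))(j := 0)) ` F. tropical_nonneg (\<lambda>i. a i * f i)"
  define m where "m = Max (range (\<lambda>i. a i * q i))"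
  have q0: "0 \<le> q i" for i
    unfolding q_def by (rule divide_nonneg_pos) (use g(2) in auto)
  have qj: "q j = 0" using g(2) by (simp add: q_def)
  have m: "a i * q i \<le> m" for i unfolding m_def by (rule Max_ge) auto
  have "m \<in> range (\<lambda>i. a i * q i)" unfolding m_def by (rule Max_in) auto
  then obtain p where p: "m = a p * q p" by blast
  have m0: "0 \<le> m" using p a0 q0 by simp
  define b where "b = a(j := m)"
  have b0: "\<forall>i. 0 \<le> b i" using a0 m0 by (simp add: b_def)
  have "tropical_nonneg (\<lambda>i. b i * f i)" if f: "f \<in> F" for f
  proof (rule tropical_nonnegI)
    fix i assume neg: "b i * f i < 0"
    define f' where "f' = (\<lambda>i. left_add (max (f j) 0 * q i) (f i))(j := 0)"
    have T: "tropical_nonneg (\<lambda>i. a i * f' i)" using aF f unfolding f'_def by blast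
    show "\<exists>k. - (b i * f i) \<le> b k * f k"
    proof (cases "i = j")
      case True
      then have "f j < 0" using neg m0 by (auto simp: b_def mult_less_0_iff)
      then have fg: "f = g" using uniq f by blast
      have "m \<noteq> 0" using neg True by (auto simp: b_def)
      then have "q p \<noteq> 0" using p by auto
      then have "p \<noteq> j" "0 < g p" using qj by (auto simp: q_def max_def split: if_splits)
      then have "b p * g p = - (m * g j)" using p g(2) by (auto simp: b_def q_def max_def)
      then show ?thesis using True fg by (intro exI[of _ p]) (auto simp: b_def)
    next
      case False
      then have neg': "a i * f i < 0" "b i = a i" using neg by (auto simp: b_def)
      show ?thesis
      \<comment> \<open>Here the term \<open>m * f j\<close> dominates; otherwise
        \<open>left_add\<close> keeps \<open>f i\<close>, and the witness for the eliminated vector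
        can be transferred.\<close>
      proof (cases "f j > 0 \<and> \<bar>f i\<bar> \<le> f j * q i")
        case True
        then have "- (a i * f i) \<le> a i * (f j * q i)"
          using a0 mult_left_mono[of "- f i" "f j * q i" "a i"] by auto
        also have "\<dots> \<le> b j * f j" using mult_right_mono[OF m[of i], of "f j"] True
          by (simp add: b_def ac_simps)
        finally show ?thesis using neg' by (intro exI[of _ j]) auto
      next
        case cF: False
        have fi: "f' i = f i" using cF False q0[of i] unfolding f'_def left_add_def
          by (auto simp: max_def abs_mult not_less)
        obtain k where k: "- (a i * f i) \<le> a k * f' k" using tropical_nonnegD[OF T, of i] fi by auto
        have kj: "k \<noteq> j" using k neg' by (auto simp: f'_def)
        show ?thesis
        proof (cases "f' k = f k")
          case True
          then show ?thesis using k kj neg' by (intro exI[of _ k]) (auto simp: b_def)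
        next
          case neq: False
          then have fk: "f' k = max (f j) 0 * q k" using kj by (auto simp: f'_def left_add_def split: if_splits)
          then have fj: "0 < f j" using k neg' by (auto simp: max_def split: if_splits)
          have "a k * f' k \<le> b j * f j" using mult_right_mono[OF m[of k], of "f j"] fj fk
            by (simp add: b_def ac_simps)
          then show ?thesis using k neg' by (intro exI[of _ j]) auto
        qed
      qed
    qed
  qed
  then have T: "tropical_nonneg (\<lambda>i. b i * x i)" using ent b0 unfolding entails_def by blast
  define x' where "x' = (\<lambda>i. left_add (x i) (x j * q i))(j := 0)"
  show "tropical_nonneg (\<lambda>i. a i * x' i)"
  proof (rule tropical_nonnegI)
    fix i assume neg: "a i * x' i < 0"
    then have ij: "i \<noteq> j" by (auto simp: x'_def)
    obtain l where l: "- (a i * x' i) \<le> - (b l * x l)"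
    proof (cases "x' i = x i")
      case True then show ?thesis using that[of i] ij by (simp add: b_def)
    next
      case False
      then have "x' i = x j * q i" using ij by (auto simp: x'_def left_add_def split: if_splits)
      then show ?thesis using that[of j] mult_left_mono_neg[OF m[of i], of "x j"] xj
        by (simp add: b_def ac_simps)
    qed
    \<comment> \<open>\<open>l'\<close> also dominates the term at \<open>j\<close>. The positive
      term \<open>k\<close> answering it is then too large for \<open>left_add\<close> to replace
      \<open>x k\<close> by \<open>x j * q k\<close>.\<close>
    obtain l' where l': "- (a i * x' i) \<le> - (b l' * x l')" "- (m * x j) \<le> - (b l' * x l')"
    proof (cases "- (b l * x l) \<le> - (m * x j)")
      case True then show ?thesis using that[of j] l by (simp add: b_def)
    next
      case False then show ?thesis using that[of l] l by simp
    qed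
    obtain k where k: "- (b l' * x l') \<le> b k * x k" using tropical_nonnegD[OF T, of l'] by auto
    have pos: "0 < b k * x k" using k l' neg by linarith
    have kj: "k \<noteq> j" using pos m0 xj by (auto simp: b_def zero_less_mult_iff)
    have ak: "0 < a k" "0 < x k" using pos a0 kj by (auto simp: b_def zero_less_mult_iff)
       (smt (verit))+
    have "x' k = x k"
    proof (rule ccontr)
      assume "x' k \<noteq> x k"
      then have "x k < - (x j * q k)" using kj ak xj q0[of k]
        by (auto simp: x'_def left_add_def abs_mult split: if_splits)
      then have "a k * x k < - (x j * (a k * q k))" using ak mult_strict_left_mono[of "x k" "- (x j * q k)" "a k"]
        by (simp add: ac_simps)
      also have "\<dots> \<le> - (m * x j)" using mult_left_mono_neg[OF m[of k], of "x j"] xj by (simp add: ac_simps)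
      finally show False using k l' kj by (simp add: b_def)
    qed
    then show "\<exists>k. - (a i * x' i) \<le> a k * x' k"
      using k l' kj by (intro exI[of _ k]) (auto simp: b_def)
  qed
qed

lemma aboveI: "u \<in> W \<Longrightarrow> (\<And>i. u i \<le> z i) \<Longrightarrow> z \<in> above W"
  unfolding above_def by blast

text \<open>Fourier-Motzkin elimination, by induction on a set \<open>J\<close> containing all
  supports. Once a single vector \<open>g\<close> is negative at \<open>j\<close>, the eliminated
  system and target vanish at \<open>j\<close>, and adding a multiple of a vector below
  \<open>g\<close> to the solution for that target recovers \<open>x\<close>.\<close>

lemma farkas_orthant:
  fixes x :: "'e::finite \<Rightarrow> real"
  assumes W: "left_cone W" "(\<lambda>_. 0) \<in> W"
  assumes "finite F" "F \<subseteq> above W" "entails F x"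
    and "\<And>f i. f \<in> F \<Longrightarrow> i \<notin> J \<Longrightarrow> f i = 0" "\<And>i. i \<notin> J \<Longrightarrow> x i = 0"
  shows "x \<in> above W"
  using assms(3-)
proof (induction "card J" arbitrary: J F x rule: less_induct)
  case less
  show ?case
  proof (cases "\<forall>i. 0 \<le> x i")
    case True then show ?thesis using W(2) by (auto simp: above_def)
  next
    case False
    then obtain j where xj: "x j < 0" by (auto simp: not_le)
    then have jJ: "j \<in> J" using less.prems(5)[of j] by auto
    define X where "X = {f \<in> above W. \<forall>i. i \<notin> J \<longrightarrow> f i = 0}"
    have X0: "f(j := 0) \<in> X" if fX: "f \<in> X" "f j < 0" for f
    proof -
      obtain u where u: "u \<in> W" "\<And>i. u i \<le> f i" using fX(1) unfolding X_def above_def by blast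
      have "u j \<le> 0" using u(2)[of j] fX(2) by linarith
      then have "u i \<le> (f(j := 0)) i" for i using u(2)[of i] by simp
      then have "f(j := 0) \<in> above W" by (rule aboveI[OF u(1)])
      moreover have "\<forall>i. i \<notin> J \<longrightarrow> (f(j := 0)) i = 0" using fX(1) by (simp add: X_def)
      ultimately show ?thesis unfolding X_def by blast
    qed
    have "F \<subseteq> X" using less.prems unfolding X_def by auto
    then obtain G where G: "finite G" "G \<subseteq> X" "entails G x" 
      and uniq: "\<forall>g\<in>G. \<forall>h\<in>G. g j < 0 \<longrightarrow> h j < 0 \<longrightarrow> g = h"
      using entails_unique[of F X x j, OF less.prems(1) _ less.prems(3) X0] by metis
    have "\<exists>g\<in>G. g j < 0"
    proof (rule ccontr)
      assume "\<not> ?thesis"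
      then have nn: "\<And>g. g \<in> G \<Longrightarrow> 0 \<le> g j" by (auto simp: not_less)
      \<comment> \<open>The unit coefficient at \<open>j\<close> satisfies any system without
        negative entries at \<open>j\<close>, but fails for \<open>x\<close>.\<close>
      define a :: "'e \<Rightarrow> real" where "a = (\<lambda>_. 0)(j := 1)"
      have "tropical_nonneg (\<lambda>i. a i * g i)" if "g \<in> G" for g
        by (rule tropical_nonnegI) (use nn[OF that] in \<open>auto simp: a_def split: if_splits\<close>)
      then have "tropical_nonneg (\<lambda>i. a i * x i)" using G(3) unfolding entails_def a_def by auto
      then obtain k where "- (a j * x j) \<le> a k * x k"
        using tropical_nonnegD[of "\<lambda>i. a i * x i" j] by blast
      then show False using xj by (auto simp: a_def split: if_splits)
    qed
    then obtain g where g: "g \<in> G" "g j < 0" by blast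
    define q where "q = (\<lambda>i. max (g i) 0 / (- g j))"
    define G' where "G' = (\<lambda>f. (\<lambda>i. left_add (max (f j) 0 * q i) (f i))(j := 0)) ` G"
    define x' where "x' = (\<lambda>i. left_add (x i) (x j * q i))(j := 0)"
    have ent: "entails G' x'" unfolding G'_def x'_def q_def
      by (rule entails_elim) (use G g xj uniq in auto)
    have q0: "0 \<le> q i" for i
    unfolding q_def by (rule divide_nonneg_pos) (use g(2) in auto)
    have qJ: "q i = 0" if "i \<notin> J" for i using that G(2) g(1) by (auto simp: q_def X_def)
    obtain ug where ug: "ug \<in> W" "\<And>i. ug i \<le> g i" using g(1) G(2) by (auto simp: X_def above_def)
    have ugq: "c / (- g j) * ug i \<le> c * q i" if "0 \<le> c" for c i
    proof -
      have "c / (- g j) * ug i \<le> c / (- g j) * max (g i) 0"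
        by (rule mult_left_mono) (use ug(2)[of i] that g(2) in \<open>auto simp: divide_nonneg_pos divide_nonneg_neg\<close>)
      then show ?thesis by (simp add: q_def)
    qed
    have ugj: "c / (- g j) * ug j \<le> - c" if "0 \<le> c" for c
    proof -
      have "c / (- g j) * ug j \<le> c / (- g j) * g j"
        by (rule mult_left_mono) (use ug(2)[of j] that g(2) in \<open>auto simp: divide_nonneg_pos divide_nonneg_neg\<close>)
      then show ?thesis using g(2) by simp
    qed
    have "G' \<subseteq> above W"
    proof
      fix f' assume "f' \<in> G'"
      then obtain f where f: "f \<in> G" and f': "f' = (\<lambda>i. left_add (max (f j) 0 * q i) (f i))(j := 0)"
        by (auto simp: G'_def)
      obtain u where u: "u \<in> W" "\<And>i. u i \<le> f i" using f G(2) by (auto simp: X_def above_def)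
      show "f' \<in> above W"
      proof (cases "f j > 0")
        case True
        \<comment> \<open>This factor makes the entry of \<open>c * ug\<close> at \<open>j\<close>
          at most \<open>- f j\<close>; standing on the left, it wins the cancellation, so the sum
          is at most 0 at \<open>j\<close>.\<close>
        define c where "c = f j / (- g j)"
        have c: "0 < c" using True g(2) by (simp add: c_def divide_pos_neg)
        have cu: "(\<lambda>i. left_add (c * ug i) (u i)) \<in> W"
          using W(1) c ug(1) u(1) by (auto simp: left_cone_def)
        have le: "left_add (c * ug i) (u i) \<le> f' i" for i
        proof (cases "i = j")
          case True
          have "left_add (c * ug j) (u j) \<le> left_add (- f j) (f j)"
            by (rule left_add_mono) (use ugj[of "f j"] u(2)[of j] \<open>f j > 0\<close> in \<open>auto simp: c_def\<close>)
          then show ?thesis using True \<open>f j > 0\<close> f' by (auto simp: left_add_def)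
        next
          case False
          have "left_add (c * ug i) (u i) \<le> left_add (f j * q i) (f i)"
            by (rule left_add_mono) (use ugq[of "f j" i] u(2)[of i] \<open>f j > 0\<close> in \<open>auto simp: c_def\<close>)
          then show ?thesis using False \<open>f j > 0\<close> f' by auto
        qed
        show ?thesis by (rule aboveI[OF cu le])
      next
        case False
        have "u i \<le> f' i" for i using False u(2)[of i] f' by (auto simp: left_add_def max_def)
        then show ?thesis by (rule aboveI[OF u(1)])
      qed
    qed
    moreover have "finite G'" using G(1) by (simp add: G'_def)
    moreover have "card (J - {j}) < card J" by (rule card_Diff1_less) (use jJ in auto)
    moreover have "f i = 0" if "f \<in> G'" "i \<notin> J - {j}" for f i
      using that G(2) qJ by (auto simp: G'_def X_def left_add_def)
    moreover have "x' i = 0" if "i \<notin> J - {j}" for i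
      using that less.prems(5)[of i] qJ[of i] by (auto simp: x'_def left_add_def)
    ultimately have "x' \<in> above W" using less.hyps[of "J - {j}" G' x'] ent by blast
    then obtain u where u: "u \<in> W" "\<And>i. u i \<le> x' i" by (auto simp: above_def)
    define c where "c = - x j / (- g j)"
    have c: "0 < c" using xj g(2) by (simp add: c_def divide_neg_neg)
    have "(\<lambda>i. left_add (u i) (c * ug i)) \<in> W"
      using W(1) c ug(1) u(1) by (auto simp: left_cone_def)
    \<comment> \<open>The order matters off \<open>j\<close>: when \<open>x j * q i\<close> has
      replaced \<open>x i\<close>, its tie with its own negative must go to the former, which is at
      most \<open>x i\<close>.\<close>
    moreover have "left_add (u i) (c * ug i) \<le> x i" for i
    proof (cases "i = j")
      case True
      have "c * ug j \<le> x j" using ugj[of "- x j"] xj by (auto simp: c_def)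
      moreover have "u j \<le> 0" using u(2)[of j] by (simp add: x'_def)
      ultimately show ?thesis using True xj by (auto simp: left_add_def)
    next
      case False
      have "left_add (u i) (c * ug i) \<le> left_add (left_add (x i) (x j * q i)) (- (x j * q i))"
        by (rule left_add_mono) (use False u(2)[of i] ugq[of "- x j" i] xj in \<open>auto simp: x'_def c_def\<close>)
      also have "\<dots> \<le> x i"
        using mult_nonpos_nonneg[of "x j" "q i"] xj q0[of i] by (auto simp: left_add_def)
      finally show ?thesis .
    qed
    ultimately show ?thesis by (rule aboveI)
  qed
qed


section \<open>Separation from cones closed under left sums and elimination\<close>

text \<open>
  Elimination is allowed only at a coordinate which is the only one that cancels: when several
  coordinates cancel simultaneously, a TC-segment need not contain any point with one of them eliminated.
\<close>

definition elim_closed :: "('e \<Rightarrow> real) set \<Rightarrow> bool" where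
  "elim_closed W \<longleftrightarrow> (\<forall>u\<in>W. \<forall>v\<in>W. \<forall>b. u b \<noteq> 0 \<longrightarrow> v b = - u b \<longrightarrow>
     (\<forall>c. c \<noteq> b \<longrightarrow> u c \<noteq> 0 \<longrightarrow> v c \<noteq> - u c) \<longrightarrow> (\<lambda>i. left_add (u i) (v i))(b := 0) \<in> W)"

lemma left_cone_scale: "left_cone W \<Longrightarrow> u \<in> W \<Longrightarrow> 0 < c \<Longrightarrow> (\<lambda>i. c * u i) \<in> W"
  by (auto simp: left_cone_def)

lemma left_cone_left_add: "left_cone W \<Longrightarrow> u \<in> W \<Longrightarrow> v \<in> W \<Longrightarrow> (\<lambda>i. left_add (u i) (v i)) \<in> W"
  by (auto simp: left_cone_def)

text \<open>Reflecting the coordinates with \<open>s i = - 1\<close> reduces this to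
  \<open>farkas_orthant\<close>: \<open>left_add\<close> commutes with sign changes, and the signs
  move into the coefficients, which are arbitrary in the hypothesis.\<close>

lemma farkas_signed:
  fixes x :: "'e::finite \<Rightarrow> real"
  assumes W: "left_cone W" "(\<lambda>_. 0) \<in> W" and F: "finite F" "F \<subseteq> W"
    and ent: "\<And>a. (\<forall>f\<in>F. tropical_nonneg (\<lambda>i. a i * f i)) \<Longrightarrow> tropical_nonneg (\<lambda>i. a i * x i)"
    and s: "\<And>i. s i = 1 \<or> s i = - 1"
  shows "\<exists>u\<in>W. \<forall>i. s i * u i \<le> s i * x i"
proof -
  define flip where "flip = (\<lambda>(u::'e \<Rightarrow> real) i. s i * u i)"
  have ss: "s i * s i = 1" "\<bar>s i\<bar> = 1" for i using s[of i] by auto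
  have left_add: "s i * left_add p q = left_add (s i * p) (s i * q)" for i p q
    using ss(2)[of i] by (auto simp: left_add_def abs_mult)
  have "flip x \<in> above (flip ` W)"
  proof (rule farkas_orthant[of _ "flip ` F" _ UNIV])
    show "left_cone (flip ` W)" unfolding left_cone_def
    proof (intro conjI ballI allI impI)
      fix u :: "'e \<Rightarrow> real" and c :: real assume "u \<in> flip ` W" "0 < c"
      then obtain w where "w \<in> W" "u = flip w" by blast
      then show "(\<lambda>i. c * u i) \<in> flip ` W"
        using left_cone_scale[OF W(1) _ \<open>0 < c\<close>, of w] by (auto simp: flip_def ac_simps intro!: image_eqI)
    next
      fix u v assume "u \<in> flip ` W" "v \<in> flip ` W"
      then obtain w w' where "w \<in> W" "u = flip w" "w' \<in> W" "v = flip w'" by blast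
      moreover from this have "(\<lambda>i. left_add (u i) (v i)) = flip (\<lambda>i. left_add (w i) (w' i))"
        by (simp add: flip_def left_add)
      ultimately show "(\<lambda>i. left_add (u i) (v i)) \<in> flip ` W"
        using left_cone_left_add[OF W(1), of w w'] by blast
    qed
    show "(\<lambda>_. 0) \<in> flip ` W" using W(2) by (auto simp: flip_def image_iff intro!: bexI)
    show "finite (flip ` F)" using F(1) by simp
    show "flip ` F \<subseteq> above (flip ` W)" using F(2) by (auto simp: above_def)
    show "entails (flip ` F) (flip x)" unfolding entails_def
    proof (intro allI impI)
      fix a :: "'e \<Rightarrow> real" assume *: "\<forall>f\<in>flip ` F. tropical_nonneg (\<lambda>i. a i * f i)"
      have "tropical_nonneg (\<lambda>i. (a i * s i) * x i)"
        by (rule ent) (use * in \<open>auto simp: flip_def ac_simps\<close>)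
      then show "tropical_nonneg (\<lambda>i. a i * flip x i)" by (simp add: flip_def ac_simps)
    qed
  qed auto
  then show ?thesis by (auto simp: above_def flip_def)
qed

lemma elim_combine:
  fixes u v :: "'e \<Rightarrow> real"
  assumes W: "left_cone W" "elim_closed W" and uv: "u \<in> W" "v \<in> W" and b: "u b < 0" "0 < v b"
    and c: "0 < c" "c * v b = - u b"
    and nc: "\<And>i. i \<noteq> b \<Longrightarrow> u i \<noteq> 0 \<Longrightarrow> u i \<noteq> - (c * v i)"
  shows "(\<lambda>i. left_add (u i) (c * v i))(b := 0) \<in> W"
proof -
  have "(\<lambda>i. c * v i) \<in> W" using left_cone_scale[OF W(1) uv(2) c(1)] .
  moreover have "\<forall>i. i \<noteq> b \<longrightarrow> u i \<noteq> 0 \<longrightarrow> c * v i \<noteq> - u i" using nc by force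
  moreover have "u b \<noteq> 0" using b by simp
  ultimately show ?thesis
    using W(2)[unfolded elim_closed_def, rule_format, of u "\<lambda>i. c * v i" b] uv(1) c(2) by blast
qed

text \<open>Rules out unwanted cancellations at coordinates outside \<open>S\<close>.\<close>

lemma same_sign_cancel:
  fixes p q :: real
  assumes "s = 1 \<or> s = - 1" "s * p \<le> 0" "s * q \<le> 0" "0 < c" "p = - (c * q)"
  shows "p = 0"
proof -
  have "0 \<le> c * (s * q)" using assms(2,5) by (simp add: ac_simps)
  then have "0 \<le> s * q" using assms(4) by (simp add: zero_le_mult_iff)
  then have "q = 0" using assms(1,3) by auto
  then show ?thesis using assms(5) by simp
qed

text \<open>
  The intermediate goal in producing the indicator vector of \<open>S\<close>: already correct on \<open>A\<close>,
  of prescribed weak sign \<open>- s\<close> outside \<open>S\<close>.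
\<close>

definition pinned where
  "pinned s S A w \<longleftrightarrow> (\<forall>i\<in>A. w i = 1) \<and> (\<forall>i\<in>S - A. 1 \<le> w i) \<and> (\<forall>i. i \<notin> S \<longrightarrow> s i * w i \<le> (0::real))"

lemma left_add_same_sign: "s * p \<le> 0 \<Longrightarrow> s * q \<le> 0 \<Longrightarrow> s * left_add p q \<le> (0::real)"
  by (auto simp: left_add_def)

lemma left_add_nonneg: "0 \<le> p \<Longrightarrow> 0 \<le> q \<Longrightarrow> left_add p q = max p q"
  by (auto simp: left_add_def)

text \<open>
  Negative entries on \<open>A\<close> are removed in order of increasing absolute value. For the smallest one, at \<open>b\<close>,
  the multiple of \<open>u b\<close> that cancels it is at the other coordinates of \<open>A\<close> too small to cancel anything,
  because \<open>u b\<close> is larger at \<open>b\<close> than elsewhere on \<open>A\<close>.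
\<close>

lemma pinned_make_nonneg:
  fixes v :: "'e::finite \<Rightarrow> real"
  assumes W: "left_cone W" "elim_closed W"
    and s: "\<And>i. s i = 1 \<or> s i = - 1"
    and AS: "A \<subseteq> S"
    and u: "\<And>b. b \<in> A \<Longrightarrow> u b \<in> W \<and> pinned s S (A - {b}) (u b) \<and> 1 < u b b"
    and v: "v \<in> W" "\<forall>i\<in>A. v i \<le> 1" "\<forall>i\<in>S - A. 1 \<le> v i" "\<forall>i. i \<notin> S \<longrightarrow> s i * v i \<le> 0"
  shows "\<exists>w\<in>W. (\<forall>i\<in>A. 0 \<le> w i \<and> w i \<le> 1) \<and> (\<forall>i\<in>S - A. 1 \<le> w i) \<and> (\<forall>i. i \<notin> S \<longrightarrow> s i * w i \<le> 0)"
  using v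
proof (induction "card {i\<in>A. v i < 0}" arbitrary: v rule: less_induct)
  case less
  show ?case
  proof (cases "{i\<in>A. v i < 0} = {}")
    case True
    then have "\<forall>i\<in>A. 0 \<le> v i" by (auto simp: not_less)
    then show ?thesis using less.prems by (intro bexI[of _ v]) auto
  next
    case False
    define N where "N = {i\<in>A. v i < 0}"
    obtain b where b: "b \<in> N" and bmin: "\<And>c. c \<in> N \<Longrightarrow> - v b \<le> - v c"
      using ex_is_arg_min_if_finite[of N "\<lambda>i. - v i"] False unfolding N_def is_arg_min_linorder
      by auto
    define z where "z = u b"
    have bA: "b \<in> A" "v b < 0" using b by (auto simp: N_def)
    have z: "z \<in> W" "pinned s S (A - {b}) z" "1 < z b" using u[OF bA(1)] by (auto simp: z_def)
    define c where "c = - v b / z b"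
    have c: "0 < c" "c * z b = - v b" using bA z(3) by (auto simp: c_def divide_neg_pos)
    have cv: "c < - v b" using bA z(3) c by (simp add: c_def field_simps)
    have zA: "z i = 1" if "i \<in> A" "i \<noteq> b" for i using z(2) that by (auto simp: pinned_def)
    have zS: "1 \<le> z i" if "i \<in> S - A" for i using z(2) that AS by (auto simp: pinned_def)
    have zE: "s i * z i \<le> 0" if "i \<notin> S" for i using z(2) that by (auto simp: pinned_def)
    have nc: "v i \<noteq> - (c * z i)" if "i \<noteq> b" "v i \<noteq> 0" for i
    proof -
      consider "i \<in> N" | "i \<in> A" "0 \<le> v i" | "i \<in> S - A" | "i \<notin> S" using N_def by fastforce
      then show ?thesis
      proof cases
        case 1 then show ?thesis using bmin[of i] cv zA[of i] that N_def by auto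
      next
        case 2 then show ?thesis using zA[of i] that c by auto
      next
        case 3
        then have "1 \<le> v i" "0 < c * z i" using less.prems(3) zS[of i] c by auto
        then show ?thesis by linarith
      next
        case 4
        then have *: "s i * v i \<le> 0" "s i * z i \<le> 0" using less.prems(4) zE by auto
        show ?thesis using same_sign_cancel[OF s[of i] * c(1)] that by blast
      qed
    qed
    define y where "y = (\<lambda>i. left_add (v i) (c * z i))(b := 0)"
    have y: "y \<in> W" unfolding y_def
      by (rule elim_combine[OF W less.prems(1) z(1) bA(2) _ c nc]) (use z(3) in auto)
    \<comment> \<open>Entries of \<open>y\<close> on \<open>A\<close> are at most
      \<open>max 1 c\<close>, those on \<open>S - A\<close> at least \<open>max 1 c\<close>, so one
      rescaling restores both bounds.\<close>
    define d where "d = inverse (max 1 c)"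
    have d: "0 < d" "d * max 1 c = 1" "d \<le> 1" by (auto simp: d_def inverse_le_1_iff)
    define y' where "y' = (\<lambda>i. d * y i)"
    have y': "y' \<in> W" unfolding y'_def by (rule left_cone_scale[OF W(1) y d(1)])
    have yN: "y i = v i" if "i \<in> N" "i \<noteq> b" for i
      using bmin[OF that(1)] cv c zA[of i] that by (auto simp: y_def left_add_def N_def)
    have yA: "y i = max (v i) c" if "i \<in> A" "i \<noteq> b" "0 \<le> v i" for i
      using that zA[of i] c by (simp add: y_def left_add_nonneg)
    have A1: "y' i \<le> 1" "0 \<le> v i \<or> i = b \<Longrightarrow> 0 \<le> y' i" if i: "i \<in> A" for i
    proof -
      have "y' i \<le> 1 \<and> (0 \<le> v i \<or> i = b \<longrightarrow> 0 \<le> y' i)"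
      proof (cases "i = b")
        case True then show ?thesis by (simp add: y'_def y_def)
      next
        case False
        show ?thesis
        proof (cases "0 \<le> v i")
          case True
          then have "y i \<le> max 1 c" "0 \<le> y i" using yA[OF i False True] less.prems(2) i by auto
          then show ?thesis using mult_left_mono[of "y i" "max 1 c" d] d by (simp add: y'_def)
        next
          case neg: False
          then have "y i < 0" using yN[of i] i False by (simp add: N_def)
          then have "d * y i < 0" using d(1) by (simp add: mult_pos_neg)
          then show ?thesis using neg False by (simp add: y'_def)
        qed
      qed
      then show "y' i \<le> 1" "0 \<le> v i \<or> i = b \<Longrightarrow> 0 \<le> y' i" by auto
    qed
    have S1: "\<forall>i\<in>S - A. 1 \<le> y' i"
    proof
      fix i assume i: "i \<in> S - A"
      have le: "1 \<le> v i" "c \<le> c * z i" using less.prems(3) zS[OF i] i c by auto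
      have "i \<noteq> b" using i bA by auto
      then have "y i = max (v i) (c * z i)" using le c by (simp add: y_def left_add_nonneg)
      then have "max 1 c \<le> y i" using max.mono[OF le] by simp
      then show "1 \<le> y' i" using mult_left_mono[of "max 1 c" "y i" d] d by (simp add: y'_def)
    qed
    have E1: "\<forall>i. i \<notin> S \<longrightarrow> s i * y' i \<le> 0"
    proof (intro allI impI)
      fix i assume i: "i \<notin> S"
      have "s i * (c * z i) \<le> 0" using zE[OF i] c(1) mult_left_mono[of "s i * z i" 0 c] by (simp add: ac_simps)
      then have "s i * y i \<le> 0" using i less.prems(4) by (auto simp: y_def intro: left_add_same_sign)
      then show "s i * y' i \<le> 0" using d(1) mult_left_mono[of "s i * y i" 0 d] by (simp add: y'_def ac_simps)
    qed
    have "{i\<in>A. y' i < 0} \<subset> {i\<in>A. v i < 0}"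
      using A1(2) bA by (force simp: not_less)
    then have "card {i\<in>A. y' i < 0} < card {i\<in>A. v i < 0}" by (intro psubset_card_mono) auto
    then show ?thesis using less.hyps[of y'] y' A1(1) S1 E1 by blast
  qed
qed

text \<open>The entries on \<open>A\<close> are raised to 1 one at a time. Scaled to be 1 at
  \<open>b\<close>, the vector \<open>u b\<close> is at most 1 on the rest of \<open>A\<close>; as
  all entries on \<open>S\<close> are nonnegative, \<open>left_add\<close> acts there as a maximum
  and keeps the entries already raised.\<close>

lemma pinned_step:
  fixes v :: "'e::finite \<Rightarrow> real"
  assumes W: "left_cone W" and AS: "A \<subseteq> S"
    and u: "\<And>b. b \<in> A \<Longrightarrow> u b \<in> W \<and> pinned s S (A - {b}) (u b) \<and> 1 < u b b"
    and v: "v \<in> W" "\<forall>i\<in>A. 0 \<le> v i \<and> v i \<le> 1" "\<forall>i\<in>S - A. 1 \<le> v i" "\<forall>i. i \<notin> S \<longrightarrow> s i * v i \<le> 0"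
  shows "\<exists>w\<in>W. pinned s S A w"
proof -
  have "\<exists>w\<in>W. (\<forall>i\<in>A. 0 \<le> w i \<and> w i \<le> 1) \<and> (\<forall>i\<in>B. w i = 1) \<and> (\<forall>i\<in>S - A. 1 \<le> w i)
          \<and> (\<forall>i. i \<notin> S \<longrightarrow> s i * w i \<le> 0)" if "B \<subseteq> A" for B
    using finite[of B] that
  proof (induction B rule: finite_induct)
    case empty then show ?case using v by auto
  next
    case (insert b B)
    then obtain w where w: "w \<in> W" "\<forall>i\<in>A. 0 \<le> w i \<and> w i \<le> 1" "\<forall>i\<in>B. w i = 1"
      "\<forall>i\<in>S - A. 1 \<le> w i" "\<forall>i. i \<notin> S \<longrightarrow> s i * w i \<le> 0" by auto
    define z where "z = u b"
    have z: "z \<in> W" "pinned s S (A - {b}) z" "1 < z b" using u[of b] insert.prems by (auto simp: z_def)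
    define c where "c = inverse (z b)"
    have c: "0 < c" "c * z b = 1" "c \<le> 1" using z(3) by (auto simp: c_def inverse_le_1_iff)
    define y where "y = (\<lambda>i. left_add (w i) (c * z i))"
    have "y \<in> W" unfolding y_def using left_cone_left_add[OF W w(1) left_cone_scale[OF W z(1) c(1)]] .
    moreover have yA: "y i = max (w i) c" if "i \<in> A" "i \<noteq> b" for i
    proof -
      have "z i = 1" using z(2) that by (simp add: pinned_def)
      then show ?thesis using w(2) c that by (auto simp: y_def left_add_nonneg)
    qed
    moreover have yb: "y b = 1" using w(2) c insert.prems by (auto simp: y_def left_add_nonneg)
    moreover have "1 \<le> y i" if "i \<in> S - A" for i
    proof -
      have "1 \<le> z i" using z(2) that AS by (auto simp: pinned_def)
      then have "0 \<le> c * z i" using c by simp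
      moreover have "1 \<le> w i" using w(4) that by simp
      ultimately show ?thesis by (simp add: y_def left_add_nonneg)
    qed
    moreover have "s i * y i \<le> 0" if "i \<notin> S" for i
    proof -
      have "s i * z i \<le> 0" using z(2) that by (simp add: pinned_def)
      then have "s i * (c * z i) \<le> 0" using c(1) mult_left_mono[of "s i * z i" 0 c] by (simp add: ac_simps)
      then show ?thesis using w(5) that by (auto simp: y_def intro: left_add_same_sign)
    qed
    moreover have "0 \<le> y i \<and> y i \<le> 1" if "i \<in> A" for i
      using yA[of i] yb w(2) c that by (cases "i = b") auto
    moreover have "y i = 1" if "i \<in> insert b B" for i
      using yA[of i] yb w(3) c that insert.prems by (cases "i = b") auto
    ultimately show ?case by (intro bexI[of _ y]) auto
  qed
  from this[of A] show ?thesis by (auto simp: pinned_def)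
qed

text \<open>By induction each \<open>b\<close> in \<open>A\<close> has a vector pinned on
  \<open>A - {b}\<close>. If one of them is 1 at \<open>b\<close>, it is pinned on \<open>A\<close>;
  otherwise all exceed 1 there, which is what lets them repair the given \<open>v\<close>.\<close>

lemma pinned_exists:
  fixes s :: "'e::finite \<Rightarrow> real"
  assumes W: "left_cone W" "elim_closed W" and s: "\<And>i. s i = 1 \<or> s i = - 1"
    and v: "\<And>A. A \<subseteq> S \<Longrightarrow> \<exists>v\<in>W. (\<forall>i\<in>A. v i \<le> 1) \<and> (\<forall>i\<in>S - A. 1 \<le> v i) \<and> (\<forall>i. i \<notin> S \<longrightarrow> s i * v i \<le> 0)"
    and "A \<subseteq> S"
  shows "\<exists>w\<in>W. pinned s S A w"
  using assms(5)
proof (induction "card A" arbitrary: A rule: less_induct)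
  case less
  have "\<exists>w\<in>W. pinned s S (A - {b}) w" if "b \<in> A" for b
    by (rule less.hyps) (use that less.prems card_Diff1_less[of A b] in auto)
  then obtain u where u: "\<And>b. b \<in> A \<Longrightarrow> u b \<in> W \<and> pinned s S (A - {b}) (u b)" by metis
  show ?case
  proof (cases "\<exists>b\<in>A. u b b = 1")
    case True
    then obtain b where "b \<in> A" "u b b = 1" by blast
    then have "pinned s S A (u b)" using u[of b] by (auto simp: pinned_def)
    then show ?thesis using u \<open>b \<in> A\<close> by blast
  next
    case False
    have u': "u b \<in> W \<and> pinned s S (A - {b}) (u b) \<and> 1 < u b b" if "b \<in> A" for b
    proof -
      have "1 \<le> u b b" using u[OF that] that less.prems by (auto simp: pinned_def)
      then show ?thesis using u[OF that] False that by force
    qed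
    obtain v' where "v' \<in> W" "\<forall>i\<in>A. v' i \<le> 1" "\<forall>i\<in>S - A. 1 \<le> v' i" "\<forall>i. i \<notin> S \<longrightarrow> s i * v' i \<le> 0"
      using v[OF less.prems] by blast
    from pinned_make_nonneg[of W s A S u, OF W s less.prems u' this] obtain w where
      "w \<in> W" "\<forall>i\<in>A. 0 \<le> w i \<and> w i \<le> 1" "\<forall>i\<in>S - A. 1 \<le> w i" "\<forall>i. i \<notin> S \<longrightarrow> s i * w i \<le> 0" by blast
    from pinned_step[of W A S u s, OF W(1) less.prems u' this] show ?thesis .
  qed
qed

text \<open>Coordinates outside \<open>S\<close> are zeroed one by one. Two vectors with opposite
  signs prescribed at \<open>j\<close> have multiples cancelling there; elsewhere they share the
  weak sign, so \<open>j\<close> is the only coordinate that cancels.\<close>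

lemma indicator_mem:
  fixes W :: "('e::finite \<Rightarrow> real) set"
  assumes W: "left_cone W" "elim_closed W"
    and t: "\<And>s. (\<And>i. s i = 1 \<or> s i = - 1) \<Longrightarrow> \<exists>w\<in>W. pinned s S S w"
  shows "(\<lambda>i. if i \<in> S then 1 else 0) \<in> W"
proof -
  have "\<exists>w\<in>W. pinned s S S w \<and> (\<forall>i\<in>D. w i = 0)"
    if "D \<inter> S = {}" and s: "\<And>i. s i = 1 \<or> s i = - 1" for D s
    using finite[of D] that
  proof (induction D arbitrary: s rule: finite_induct)
    case empty then show ?case using t[of s] by auto
  next
    case (insert j D)
    have jS: "j \<notin> S" using insert.prems by auto
    have DS: "D \<inter> S = {}" using insert.prems(1) by auto
    have upd: "(s(j := t)) i = 1 \<or> (s(j := t)) i = - 1" if "t = 1 \<or> t = - 1" for t i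
      using insert.prems(2)[of i] that by simp
    obtain u where u: "u \<in> W" "pinned (s(j := 1)) S S u" "\<forall>i\<in>D. u i = 0"
      using insert.IH[of "s(j := 1)", OF DS upd] by blast
    obtain v where v: "v \<in> W" "pinned (s(j := - 1)) S S v" "\<forall>i\<in>D. v i = 0"
      using insert.IH[of "s(j := - 1)", OF DS upd] by blast
    have uv: "u j \<le> 0" "0 \<le> v j" using u(2) v(2) jS by (auto simp: pinned_def split: if_splits)
    have uS: "u i = 1" "v i = 1" if "i \<in> S" for i using u(2) v(2) that by (auto simp: pinned_def)
    have uE: "s i * u i \<le> 0" "s i * v i \<le> 0" if "i \<notin> S" "i \<noteq> j" for i
      using u(2) v(2) that by (auto simp: pinned_def split: if_splits)
    show ?case
    proof (cases "u j = 0 \<or> v j = 0")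
      case True
      then show ?thesis
      proof
        assume "u j = 0"
        then have "pinned s S S u" using uS uE by (fastforce simp: pinned_def)
        then show ?thesis using u \<open>u j = 0\<close> by (intro bexI[of _ u]) auto
      next
        assume "v j = 0"
        then have "pinned s S S v" using uS uE by (fastforce simp: pinned_def)
        then show ?thesis using v \<open>v j = 0\<close> by (intro bexI[of _ v]) auto
      qed
    next
      case False
      then have neg: "u j < 0" "0 < v j" using uv by auto
      define c where "c = - u j / v j"
      have c: "0 < c" "c * v j = - u j" using neg by (auto simp: c_def divide_neg_pos)
      have nc: "u i \<noteq> - (c * v i)" if "i \<noteq> j" "u i \<noteq> 0" for i
      proof (cases "i \<in> S")
        case True then show ?thesis using uS c by auto
      next
        case iS: False
        show ?thesis using same_sign_cancel[OF insert.prems(2)[of i] uE[OF iS that(1)] c(1)] that by blast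
      qed
      define y where "y = (\<lambda>i. left_add (u i) (c * v i))(j := 0)"
      have y: "y \<in> W" unfolding y_def by (rule elim_combine[OF W u(1) v(1) neg c nc])
      define d where "d = inverse (max 1 c)"
      have d: "0 < d" "d * max 1 c = 1" by (auto simp: d_def)
      have "(\<lambda>i. d * y i) \<in> W" by (rule left_cone_scale[OF W(1) y d(1)])
      moreover have "d * y i = 1" if "i \<in> S" for i
      proof -
        have "y i = max 1 c" using that uS[of i] jS c by (auto simp: y_def left_add_nonneg)
        then show ?thesis using d by simp
      qed
      moreover have "s i * (d * y i) \<le> 0" if "i \<notin> S" for i
      proof (cases "i = j")
        case True then show ?thesis by (simp add: y_def)
      next
        case False
        have "s i * (c * v i) \<le> 0" using uE(2)[OF that False] c(1) mult_left_mono[of "s i * v i" 0 c] by (simp add: ac_simps)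
        then have "s i * y i \<le> 0" using False uE(1)[OF that False] by (auto simp: y_def intro: left_add_same_sign)
        then show ?thesis using d(1) mult_left_mono[of "s i * y i" 0 d] by (simp add: ac_simps)
      qed
      moreover have "d * y i = 0" if "i \<in> insert j D" for i
        using that u(3) v(3) by (auto simp: y_def left_add_def)
      ultimately show ?thesis by (intro bexI[of _ "\<lambda>i. d * y i"]) (auto simp: pinned_def)
    qed
  qed
  from this[of "- S" "\<lambda>_. 1"] obtain w where w: "w \<in> W" "pinned (\<lambda>_. 1) S S w" "\<forall>i\<in>- S. w i = 0" by auto
  then have "w = (\<lambda>i. if i \<in> S then 1 else 0)" by (auto simp: pinned_def)
  then show ?thesis using w by simp
qed

lemma separation_unit:
  fixes W :: "('e::finite \<Rightarrow> real) set"
  assumes W: "left_cone W" "elim_closed W" and F: "finite F" "F \<subseteq> W" and S: "S \<noteq> {}"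
    and ent: "\<And>a. (\<forall>f\<in>F. tropical_nonneg (\<lambda>i. a i * f i)) \<Longrightarrow> tropical_nonneg (\<lambda>i. a i * (if i \<in> S then 1 else 0))"
  shows "(\<lambda>i. if i \<in> S then 1 else 0) \<in> W"
proof -
  \<comment> \<open>Zero is adjoined as the starting point of the Farkas lemma; since
    \<open>S\<close> is nonempty, the vector finally obtained is not the adjoined one.\<close>
  define W0 where "W0 = insert (\<lambda>_. 0) W"
  have z: "left_add 0 p = p" "left_add p 0 = p" for p by (auto simp: left_add_def)
  have W0: "left_cone W0" "(\<lambda>_. 0) \<in> W0" "F \<subseteq> W0"
    using W(1) F(2) by (auto simp: W0_def left_cone_def z)
  have W0e: "elim_closed W0" unfolding elim_closed_def
  proof (intro ballI allI impI)
    fix u v b assume *: "u \<in> W0" "v \<in> W0" "u b \<noteq> 0" "v b = - u b"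
      "\<forall>c. c \<noteq> b \<longrightarrow> u c \<noteq> 0 \<longrightarrow> v c \<noteq> - u c"
    then have "u \<in> W" "v \<in> W" by (auto simp: W0_def)
    with * W(2) have "(\<lambda>i. left_add (u i) (v i))(b := 0) \<in> W" unfolding elim_closed_def by blast
    then show "(\<lambda>i. left_add (u i) (v i))(b := 0) \<in> W0" by (simp add: W0_def)
  qed
  have "(\<lambda>i. if i \<in> S then 1 else 0) \<in> W0"
  proof (rule indicator_mem[OF W0(1) W0e])
    fix s :: "'e \<Rightarrow> real" assume s: "\<And>i. s i = 1 \<or> s i = - 1"
    show "\<exists>w\<in>W0. pinned s S S w"
    proof (rule pinned_exists[OF W0(1) W0e s])
      fix A assume "A \<subseteq> S"
      \<comment> \<open>This pattern requests entries at most 1 on \<open>A\<close>, at least 1 on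
        \<open>S - A\<close>, and of weak sign \<open>- s\<close> elsewhere.\<close>
      define r where "r = (\<lambda>i. if i \<in> A then 1 else if i \<in> S then - 1 else s i)"
      have "\<exists>u\<in>W0. \<forall>i. r i * u i \<le> r i * (if i \<in> S then 1 else 0)"
        by (rule farkas_signed[OF W0(1,2) F(1) W0(3) ent]) (use s in \<open>auto simp: r_def\<close>)
      then obtain u where u: "u \<in> W0" "\<And>i. r i * u i \<le> r i * (if i \<in> S then 1 else 0)" by blast
      have "u i \<le> 1" if "i \<in> A" for i using u(2)[of i] that \<open>A \<subseteq> S\<close> by (auto simp: r_def split: if_splits)
      moreover have "1 \<le> u i" if "i \<in> S - A" for i using u(2)[of i] that by (auto simp: r_def)
      moreover have "s i * u i \<le> 0" if "i \<notin> S" for i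
        using u(2)[of i] that \<open>A \<subseteq> S\<close> by (auto simp: r_def split: if_splits)
      ultimately show "\<exists>v\<in>W0. (\<forall>i\<in>A. v i \<le> 1) \<and> (\<forall>i\<in>S - A. 1 \<le> v i) \<and> (\<forall>i. i \<notin> S \<longrightarrow> s i * v i \<le> 0)"
        using u(1) by blast
    qed auto
  qed
  moreover have "(\<lambda>i. if i \<in> S then 1 else 0) \<noteq> (\<lambda>_. 0::real)" using S by (auto simp: fun_eq_iff)
  ultimately show ?thesis by (auto simp: W0_def)
qed

text \<open>Rescaling each coordinate by a nonzero factor turns \<open>x\<close> into the indicator
  of its support and preserves both closure properties; the coefficients absorb the inverse
  factors.\<close>

lemma separation_cone:
  fixes x :: "'e::finite \<Rightarrow> real"
  assumes W: "left_cone W" "elim_closed W" and F: "finite F" "F \<subseteq> W" and x: "x \<notin> W" "x i0 \<noteq> 0"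
  shows "\<exists>a. (\<forall>f\<in>F. tropical_nonneg (\<lambda>i. a i * f i)) \<and> \<not> tropical_nonneg (\<lambda>i. a i * x i)"
proof (rule ccontr)
  assume nex: "\<not> ?thesis"
  define e where "e = (\<lambda>i. if x i = 0 then 1 else x i)"
  have e: "e i \<noteq> 0" for i by (simp add: e_def)
  define S where "S = {i. x i \<noteq> 0}"
  define V where "V = {w. (\<lambda>i. e i * w i) \<in> W}"
  have left_add: "e i * left_add p q = left_add (e i * p) (e i * q)" for i p q
    using e[of i] by (auto simp: left_add_def abs_mult)
  have V1: "left_cone V" using W(1) unfolding left_cone_def V_def
    by (auto simp: left_add mult.left_commute)
  have V2: "elim_closed V" unfolding elim_closed_def
  proof (intro ballI allI impI)
    fix u v b assume *: "u \<in> V" "v \<in> V" "u b \<noteq> 0" "v b = - u b"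
      "\<forall>c. c \<noteq> b \<longrightarrow> u c \<noteq> 0 \<longrightarrow> v c \<noteq> - u c"
    define u' v' where "u' = (\<lambda>i. e i * u i)" and "v' = (\<lambda>i. e i * v i)"
    have "u' \<in> W" "v' \<in> W" using * by (auto simp: V_def u'_def v'_def)
    moreover have "u' b \<noteq> 0" "v' b = - u' b" using * e by (auto simp: u'_def v'_def)
    moreover have "\<forall>c. c \<noteq> b \<longrightarrow> u' c \<noteq> 0 \<longrightarrow> v' c \<noteq> - u' c"
      using *(5) e unfolding u'_def v'_def mult_minus_right[symmetric] mult_cancel_left by simp
    ultimately have "(\<lambda>i. left_add (u' i) (v' i))(b := 0) \<in> W" using W(2) unfolding elim_closed_def by blast
    moreover have "(\<lambda>i. left_add (u' i) (v' i))(b := 0) = (\<lambda>i. e i * ((\<lambda>i. left_add (u i) (v i))(b := 0)) i)"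
      by (auto simp: u'_def v'_def left_add)
    ultimately show "(\<lambda>i. left_add (u i) (v i))(b := 0) \<in> V" by (simp add: V_def)
  qed
  have "(\<lambda>i. if i \<in> S then 1 else 0) \<in> V"
  proof (rule separation_unit[OF V1 V2])
    show "finite ((\<lambda>f i. f i / e i) ` F)" using F(1) by simp
    show "(\<lambda>f i. f i / e i) ` F \<subseteq> V" using F(2) e by (auto simp: V_def)
    show "S \<noteq> {}" using x(2) by (auto simp: S_def)
    fix a assume a: "\<forall>f\<in>(\<lambda>f i. f i / e i) ` F. tropical_nonneg (\<lambda>i. a i * f i)"
    have "\<forall>f\<in>F. tropical_nonneg (\<lambda>i. (a i / e i) * f i)" using a by simp
    then have "tropical_nonneg (\<lambda>i. (a i / e i) * x i)"
      using nex[unfolded not_ex, THEN spec, of "\<lambda>i. a i / e i"] by simp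
    moreover have "(\<lambda>i. (a i / e i) * x i) = (\<lambda>i. a i * (if i \<in> S then 1 else 0))"
      by (auto simp: S_def e_def)
    ultimately show "tropical_nonneg (\<lambda>i. a i * (if i \<in> S then 1 else 0))" by simp
  qed
  moreover have "(\<lambda>i. e i * (if i \<in> S then 1 else 0)) = x" by (auto simp: S_def e_def)
  ultimately show False using x(1) by (simp add: V_def)
qed


section \<open>Closed halfspaces in real coordinates\<close>

text \<open>The value at balanced numbers is a dummy, as vectors in \<open>T_space\<close> have no
  entry \<open>Elt Bullet r\<close>.\<close>

fun enc :: "symtrop \<Rightarrow> real" where
  "enc TZero = 0"
| "enc (Elt Plus r) = exp r"
| "enc (Elt Minus r) = - exp r"
| "enc (Elt Bullet r) = 0"

definition dec :: "real \<Rightarrow> symtrop" where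
  "dec t = (if 0 < t then Elt Plus (ln t) else if t < 0 then Elt Minus (ln (- t)) else TZero)"

fun rnorm :: "symtrop \<Rightarrow> real" where
  "rnorm TZero = 0"
| "rnorm (Elt s r) = exp r"

lemmas T_defs = T_pos_def T_neg_def T_pm_def T_bal_def zero_symtrop_def

lemma enc_dec [simp]: "enc (dec t) = t"
  by (simp add: dec_def)

lemma dec_T_pm [simp]: "dec t \<in> T_pm"
  by (auto simp: dec_def T_defs)

lemma dec_enc: "x \<in> T_pm \<Longrightarrow> dec (enc x) = x"
  by (auto simp: dec_def T_defs)

lemma rnorm_nonneg: "0 \<le> rnorm x"
  by (cases x) auto

lemma enc_mult:
  assumes "x \<in> T_pm" "y \<in> T_pm" shows "enc (x * y) = enc x * enc y" "x * y \<in> T_pm"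
  using assms by (auto simp: T_defs exp_add)

lemma rnorm_mult: "rnorm (x * y) = rnorm x * rnorm y"
  by (cases x; cases y) (auto simp: exp_add)

lemma rnorm_enc: "x \<in> T_pm \<Longrightarrow> rnorm x = \<bar>enc x\<bar>"
  by (auto simp: T_defs)

lemma neg_enc: "x \<in> T_pm \<Longrightarrow> x \<in> T_neg \<longleftrightarrow> enc x < 0"
  by (auto simp: T_defs)

text \<open>Turns the condition of a closed halfspace into a negated one: it is negativity that is
  easily described for sums.\<close>

lemma not_neg_iff: "x \<notin> T_neg \<longleftrightarrow> x \<in> T_pos \<union> T_bal"
proof (cases x)
  case (Elt s r) then show ?thesis by (cases s) (auto simp: T_defs)
qed (auto simp: T_defs)

lemma rnorm_neg: "x \<in> T_neg \<Longrightarrow> 0 < rnorm x"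
  by (auto simp: T_defs)

section \<open>Signs and norms of tropical sums\<close>

lemma rnorm_plus: "rnorm (x + y) = max (rnorm x) (rnorm y)"
  by (cases x; cases y) (auto simp: max_def)

lemma plus_neg:
  "x + y \<in> T_neg \<longleftrightarrow> (x \<in> T_neg \<and> (y \<in> T_neg \<or> rnorm y < rnorm x)) \<or> (y \<in> T_neg \<and> rnorm x < rnorm y)"
  by (cases x; cases y) (auto simp: T_defs)

lemma rnorm_le_sum: "finite I \<Longrightarrow> k \<in> I \<Longrightarrow> rnorm (t k) \<le> rnorm (\<Sum>i\<in>I. t i)"
  by (induction I rule: finite_induct) (auto simp: rnorm_plus)

lemma sum_neg_imp:
  assumes "finite I" "(\<Sum>i\<in>I. t i) \<in> T_neg"
  shows "\<exists>i\<in>I. t i \<in> T_neg \<and> rnorm (t i) = rnorm (\<Sum>i\<in>I. t i) \<and>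
    (\<forall>k\<in>I. t k \<in> T_neg \<or> rnorm (t k) < rnorm (\<Sum>i\<in>I. t i))"
  using assms
proof (induction I rule: finite_induct)
  case empty then show ?case by (auto simp: T_defs)
next
  case (insert a I)
  define S where "S = (\<Sum>i\<in>I. t i)"
  have sum: "(\<Sum>i\<in>insert a I. t i) = t a + S" using insert.hyps by (simp add: S_def)
  have le: "rnorm (t k) \<le> rnorm S" if "k \<in> I" for k
    using rnorm_le_sum[OF insert.hyps(1) that] by (simp add: S_def)
  have IH: "S \<in> T_neg \<Longrightarrow> \<exists>i\<in>I. t i \<in> T_neg \<and> rnorm (t i) = rnorm S \<and> (\<forall>k\<in>I. t k \<in> T_neg \<or> rnorm (t k) < rnorm S)"
    using insert.IH by (simp add: S_def)
  have "t a + S \<in> T_neg" using insert.prems sum by simp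
  then consider "t a \<in> T_neg" "rnorm S < rnorm (t a)" | "t a \<in> T_neg" "S \<in> T_neg" | "S \<in> T_neg" "rnorm (t a) < rnorm S"
    unfolding plus_neg by blast
  then show ?case unfolding sum rnorm_plus
  proof cases
    case 1
    then show "\<exists>i\<in>insert a I. t i \<in> T_neg \<and> rnorm (t i) = max (rnorm (t a)) (rnorm S) \<and>
      (\<forall>k\<in>insert a I. t k \<in> T_neg \<or> rnorm (t k) < max (rnorm (t a)) (rnorm S))"
      using le by (intro bexI[of _ a]) force+
  next
    case 2
    with IH obtain i where i: "i \<in> I" "t i \<in> T_neg" "rnorm (t i) = rnorm S"
      "\<forall>k\<in>I. t k \<in> T_neg \<or> rnorm (t k) < rnorm S" by blast
    show "\<exists>i\<in>insert a I. t i \<in> T_neg \<and> rnorm (t i) = max (rnorm (t a)) (rnorm S) \<and>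
      (\<forall>k\<in>insert a I. t k \<in> T_neg \<or> rnorm (t k) < max (rnorm (t a)) (rnorm S))"
    proof (cases "rnorm (t a) \<le> rnorm S")
      case True then show ?thesis using i 2 by (intro bexI[of _ i]) auto
    next
      case False then show ?thesis using i 2 by (intro bexI[of _ a]) auto
    qed
  next
    case 3
    with IH obtain i where i: "i \<in> I" "t i \<in> T_neg" "rnorm (t i) = rnorm S"
      "\<forall>k\<in>I. t k \<in> T_neg \<or> rnorm (t k) < rnorm S" by blast
    then show "\<exists>i\<in>insert a I. t i \<in> T_neg \<and> rnorm (t i) = max (rnorm (t a)) (rnorm S) \<and>
      (\<forall>k\<in>insert a I. t k \<in> T_neg \<or> rnorm (t k) < max (rnorm (t a)) (rnorm S))"
      using 3 by (intro bexI[of _ i]) auto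
  qed
qed

text \<open>An invariant for the remaining terms: adding a negative term of norm \<open>m\<close>
  gives a negative sum in either case.\<close>

lemma sum_neg_or_small:
  assumes "finite I" "0 < m" "\<And>k. k \<in> I \<Longrightarrow> t k \<in> T_neg \<or> rnorm (t k) < m"
  shows "(\<Sum>i\<in>I. t i) \<in> T_neg \<or> rnorm (\<Sum>i\<in>I. t i) < m"
  using assms(1,3)
proof (induction I rule: finite_induct)
  case empty then show ?case using assms(2) by (simp add: zero_symtrop_def)
next
  case (insert a I)
  then have "(\<Sum>i\<in>I. t i) \<in> T_neg \<or> rnorm (\<Sum>i\<in>I. t i) < m" "t a \<in> T_neg \<or> rnorm (t a) < m" by auto
  then show ?case using insert.hyps by (auto simp: plus_neg rnorm_plus)
qed

lemma sum_negI:
  assumes "finite I" "i \<in> I" "t i \<in> T_neg" "\<And>k. k \<in> I \<Longrightarrow> t k \<in> T_neg \<or> rnorm (t k) < rnorm (t i)"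
  shows "(\<Sum>i\<in>I. t i) \<in> T_neg"
proof -
  have "(\<Sum>i\<in>I - {i}. t i) \<in> T_neg \<or> rnorm (\<Sum>i\<in>I - {i}. t i) < rnorm (t i)"
    by (rule sum_neg_or_small) (use assms rnorm_neg in auto)
  then have "t i + (\<Sum>i\<in>I - {i}. t i) \<in> T_neg" using assms(3) by (auto simp: plus_neg)
  then show ?thesis using assms(1,2) by (simp add: sum.remove)
qed

lemma sum_neg_iff:
  assumes "finite I"
  shows "(\<Sum>i\<in>I. t i) \<in> T_neg \<longleftrightarrow> (\<exists>i\<in>I. t i \<in> T_neg \<and> (\<forall>k\<in>I. t k \<in> T_neg \<or> rnorm (t k) < rnorm (t i)))"
  using sum_neg_imp[OF assms, of t] sum_negI[OF assms, of _ t] by metis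

text \<open>The index \<open>None\<close> carries the constant coefficient, so that an affine form
  becomes a single sum.\<close>

definition aff_term :: "symtrop \<Rightarrow> symtrop ^ 'd \<Rightarrow> symtrop ^ 'd \<Rightarrow> 'd option \<Rightarrow> symtrop" where
  "aff_term a0 a x = case_option a0 (\<lambda>i. a $ i * x $ i)"

definition homogenize :: "symtrop ^ 'd \<Rightarrow> 'd option \<Rightarrow> real" where
  "homogenize x = case_option 1 (\<lambda>i. enc (x $ i))"

text \<open>Degenerate \<open>A\<close>, vanishing on all \<open>Some i\<close>, are allowed here;
  they are excluded separately where closed halfspaces are meant.\<close>

definition halfspace_of :: "('d option \<Rightarrow> real) \<Rightarrow> (symtrop ^ 'd) set" where
  "halfspace_of A = {x \<in> T_space. tropical_nonneg (\<lambda>i. A i * homogenize x i)}"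

lemma sum_aff_term: "a0 + (\<Sum>i\<in>UNIV. a $ i * x $ i) = (\<Sum>i\<in>UNIV. aff_term a0 a x i)"
  for a :: "symtrop ^ 'd"
proof -
  have "(\<Sum>i\<in>range Some. aff_term a0 a x i) = (\<Sum>i\<in>UNIV. a $ i * x $ i)"
    by (subst sum.reindex) (auto simp: aff_term_def)
  then show ?thesis by (simp add: UNIV_option_conv aff_term_def)
qed

lemma sum_aff_neg:
  fixes a x :: "symtrop ^ 'd"
  assumes "a0 \<in> T_pm" "a \<in> T_space" "x \<in> T_space"
  shows "(\<Sum>i\<in>UNIV. aff_term a0 a x i) \<in> T_neg \<longleftrightarrow>
    \<not> tropical_nonneg (\<lambda>i. case_option (enc a0) (\<lambda>i. enc (a $ i)) i * homogenize x i)"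
proof -
  define e where "e = (\<lambda>i. case_option (enc a0) (\<lambda>i. enc (a $ i)) i * homogenize x i)"
  have t: "aff_term a0 a x i \<in> T_pm \<and> enc (aff_term a0 a x i) = e i" for i
    using assms enc_mult by (cases i) (auto simp: aff_term_def e_def homogenize_def T_space_def)
  then have neg: "aff_term a0 a x i \<in> T_neg \<longleftrightarrow> e i < 0" and rnorm: "rnorm (aff_term a0 a x i) = \<bar>e i\<bar>" for i
    using neg_enc rnorm_enc by metis+
  have "(\<Sum>i\<in>UNIV. aff_term a0 a x i) \<in> T_neg \<longleftrightarrow> (\<exists>i. e i < 0 \<and> (\<forall>k. e k < 0 \<or> \<bar>e k\<bar> < \<bar>e i\<bar>))"
    by (simp add: sum_neg_iff neg rnorm)
  also have "\<dots> \<longleftrightarrow> (\<exists>i. \<forall>k. e k < - e i)"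
    by (rule ex_cong1) (smt (verit))
  finally show ?thesis unfolding not_tropical_nonneg e_def .
qed

lemma closed_halfspace_eq:
  fixes a :: "symtrop ^ 'd"
  assumes "a0 \<in> T_pm" "a \<in> T_space"
  shows "closed_halfspace a0 a = halfspace_of (case_option (enc a0) (\<lambda>i. enc (a $ i)))"
  unfolding closed_halfspace_def halfspace_of_def sum_aff_term not_neg_iff[symmetric]
  using sum_aff_neg[OF assms] by auto

lemma closed_halfspace_dec:
  fixes A :: "'d::finite option \<Rightarrow> real"
  shows "closed_halfspace (dec (A None)) (\<chi> i. dec (A (Some i))) = halfspace_of A"
proof -
  have "case_option (enc (dec (A None))) (\<lambda>i. enc ((\<chi> i. dec (A (Some i))) $ i)) = A"
    by (auto simp: fun_eq_iff split: option.split)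
  then show ?thesis by (subst closed_halfspace_eq) (auto simp: T_space_def)
qed

lemma is_closed_halfspace_iff:
  fixes H :: "(symtrop ^ 'd) set"
  shows "is_closed_halfspace H \<longleftrightarrow> (\<exists>A. (\<exists>i. A (Some i) \<noteq> 0) \<and> H = halfspace_of A)"
proof
  assume "is_closed_halfspace H"
  then obtain a0 a where a: "a0 \<in> T_pm" "a \<in> T_space" "a \<noteq> 0" "H = closed_halfspace a0 a"
    unfolding is_closed_halfspace_def by blast
  then obtain i where "a $ i \<noteq> 0" by (auto simp: vec_eq_iff)
  moreover have "a $ i \<in> T_pm" using a(2) by (auto simp: T_space_def)
  ultimately have "enc (a $ i) \<noteq> 0" by (auto simp: T_defs)
  then show "\<exists>A. (\<exists>i. A (Some i) \<noteq> 0) \<and> H = halfspace_of A"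
    using closed_halfspace_eq[OF a(1,2)] a(4)
    by (intro exI[of _ "case_option (enc a0) (\<lambda>i. enc (a $ i))"]) auto
next
  assume "\<exists>A. (\<exists>i. A (Some i) \<noteq> 0) \<and> H = halfspace_of A"
  then obtain A i where A: "A (Some i) \<noteq> 0" "H = halfspace_of A" by blast
  have "(\<chi> i. dec (A (Some i))) \<noteq> 0"
  proof
    assume "(\<chi> i. dec (A (Some i))) = 0"
    then have "dec (A (Some i)) = 0" by (auto simp: vec_eq_iff)
    then show False using A(1) by (auto simp: dec_def zero_symtrop_def split: if_splits)
  qed
  then show "is_closed_halfspace H" unfolding is_closed_halfspace_def
    using closed_halfspace_dec[of A] A(2)
    by (intro bexI[of _ "dec (A None)"] bexI[of _ "\<chi> i. dec (A (Some i))"]) (auto simp: T_space_def)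
qed

lemma conv_TC_iff:
  "z \<in> conv_TC x y \<longleftrightarrow> (\<forall>A. (\<exists>i. A (Some i) \<noteq> 0) \<longrightarrow> x \<in> halfspace_of A \<longrightarrow> y \<in> halfspace_of A \<longrightarrow> z \<in> halfspace_of A)"
  unfolding conv_TC_def is_closed_halfspace_iff by blast

lemma conv_TC_subset:
  fixes x y :: "symtrop ^ 'd"
  assumes "x \<in> T_space" "y \<in> T_space" shows "conv_TC x y \<subseteq> T_space"
proof
  fix z assume z: "z \<in> conv_TC x y"
  obtain i :: 'd where True by blast
  \<comment> \<open>Some halfspace must contain both points, as an empty intersection would be the
    whole type. The constant coefficient \<open>B\<close> dominates coordinate \<open>i\<close> of
    both.\<close>
  define B where "B = \<bar>enc (x $ i)\<bar> + \<bar>enc (y $ i)\<bar>"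
  define A where "A = (\<lambda>k. if k = None then B else if k = Some i then 1 else (0::real))"
  have "h \<in> halfspace_of A" if "h \<in> T_space" "\<bar>enc (h $ i)\<bar> \<le> B" for h
    unfolding halfspace_of_def mem_Collect_eq
  proof (intro conjI tropical_nonnegI)
    fix k assume "A k * homogenize h k < 0"
    then have "k = Some i" using that(2) by (cases k) (auto simp: A_def homogenize_def B_def split: if_splits)
    then show "\<exists>l. - (A k * homogenize h k) \<le> A l * homogenize h l"
      using that(2) by (intro exI[of _ None]) (auto simp: A_def homogenize_def)
  qed fact
  then have "x \<in> halfspace_of A" "y \<in> halfspace_of A" using assms by (auto simp: B_def)
  moreover have "A (Some i) \<noteq> 0" by (simp add: A_def)
  ultimately have "z \<in> halfspace_of A" using z unfolding conv_TC_iff by blast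
  then show "z \<in> T_space" by (simp add: halfspace_of_def)
qed

section \<open>The cone over a TC-convex set\<close>

text \<open>Let \<open>m\<close> be the absolute value of the most negative term of a violating
  combination. Away from \<open>b\<close> no term of \<open>u\<close> or \<open>v\<close> reaches
  \<open>m\<close>: it would have survived or lost to a larger entry, ties being excluded. At
  \<open>b\<close> the two terms are opposite, so if one reached \<open>m\<close>, the other would
  need a dominating term away from \<open>b\<close>. Hence the term at \<open>i\<close> has no
  dominating term in its own vector.\<close>

lemma tropical_nonneg_elim:
  fixes u v A :: "'e::finite \<Rightarrow> real"
  assumes u: "tropical_nonneg (\<lambda>i. A i * u i)" and v: "tropical_nonneg (\<lambda>i. A i * v i)" and b: "v b = - u b"
    and nc: "\<forall>c. c \<noteq> b \<longrightarrow> u c \<noteq> 0 \<longrightarrow> v c \<noteq> - u c"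
  shows "tropical_nonneg (\<lambda>i. A i * ((\<lambda>i. left_add (u i) (v i))(b := 0)) i)"
proof (rule ccontr)
  define w where "w = (\<lambda>i. left_add (u i) (v i))(b := 0)"
  assume "\<not> ?thesis"
  then obtain i0 where i0: "\<And>k. A k * w k < - (A i0 * w i0)" unfolding not_tropical_nonneg w_def by blast
  obtain i where imin: "\<And>k. A i * w i \<le> A k * w k"
    using ex_is_arg_min_if_finite[of UNIV "\<lambda>i. A i * w i"] unfolding is_arg_min_linorder by auto
  define m where "m = - (A i * w i)"
  have up: "A k * w k < m" for k using i0[of k] imin[of i0] unfolding m_def by linarith
  have abs: "\<bar>A k * w k\<bar> \<le> m" for k using up[of k] imin[of k] unfolding m_def by linarith
  have m0: "0 < m" using up[of i] unfolding m_def by linarith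
  then have ib: "i \<noteq> b" by (auto simp: m_def w_def)
  have no_u: "A k * u k < m" if kb: "k \<noteq> b" for k
  proof (rule ccontr)
    assume "\<not> A k * u k < m"
    then have uk: "m \<le> A k * u k" by simp
    then have neq: "w k \<noteq> u k" using up[of k] by auto
    then have "w k = v k" "\<bar>u k\<bar> < \<bar>v k\<bar>" using kb by (auto simp: w_def left_add_def split: if_splits)
    moreover have "0 < \<bar>A k\<bar>" using uk m0 by auto
    ultimately have "\<bar>A k * u k\<bar> < \<bar>A k * w k\<bar>" unfolding abs_mult by (intro mult_strict_left_mono) auto
    then show False using abs[of k] uk by linarith
  qed
  have no_v: "A k * v k < m" if kb: "k \<noteq> b" for k
  proof (rule ccontr)
    assume "\<not> A k * v k < m"
    then have vk: "m \<le> A k * v k" by simp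
    then have "w k \<noteq> v k" using up[of k] by auto
    then have w: "w k = u k" "\<bar>v k\<bar> \<le> \<bar>u k\<bar>" using kb by (auto simp: w_def left_add_def split: if_splits)
    have Ak: "0 < \<bar>A k\<bar>" using vk m0 by auto
    have "\<not> \<bar>v k\<bar> < \<bar>u k\<bar>"
    proof
      assume "\<bar>v k\<bar> < \<bar>u k\<bar>"
      then have "\<bar>A k * v k\<bar> < \<bar>A k * w k\<bar>" unfolding abs_mult w using Ak by (intro mult_strict_left_mono) auto
      then show False using abs[of k] vk by linarith
    qed
    then have "\<bar>v k\<bar> = \<bar>u k\<bar>" using w(2) by simp
    then have "v k = u k \<or> v k = - u k" by (auto simp: abs_eq_iff)
    then have "v k = - u k" using \<open>w k \<noteq> v k\<close> w(1) by auto
    moreover have "u k \<noteq> 0" using calculation vk m0 by auto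
    ultimately show False using nc kb by blast
  qed
  have vb: "A b * v b = - (A b * u b)" using b by simp
  have not_u: "\<not> (m \<le> A b * u b)"
  proof
    assume mb: "m \<le> A b * u b"
    obtain k where k: "- (A b * v b) \<le> A k * v k" using tropical_nonnegD[OF v] by blast
    then have "k \<noteq> b" using mb m0 vb by auto
    then show False using no_v[of k] k mb vb by simp
  qed
  have not_v: "\<not> (m \<le> A b * v b)"
  proof
    assume mb: "m \<le> A b * v b"
    obtain k where k: "- (A b * u b) \<le> A k * u k" using tropical_nonnegD[OF u] by blast
    then have "k \<noteq> b" using mb m0 vb by auto
    then show False using no_u[of k] k mb vb by simp
  qed
  have "w i = u i \<or> w i = v i" using ib by (auto simp: w_def left_add_def)
  then show False
  proof
    assume "w i = u i"
    then obtain k where "m \<le> A k * u k" using tropical_nonnegD[OF u, of i] by (auto simp: m_def)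
    then show False using no_u[of k] not_u by (cases "k = b") auto
  next
    assume "w i = v i"
    then obtain k where "m \<le> A k * v k" using tropical_nonnegD[OF v, of i] by (auto simp: m_def)
    then show False using no_v[of k] not_v by (cases "k = b") auto
  qed
qed

text \<open>As ties go to \<open>u\<close>, no term of \<open>u\<close> reaches the absolute value
  \<open>m\<close> of the most negative term, which therefore stems from \<open>v\<close>. The term
  of \<open>v\<close> dominating it was overruled by a term of \<open>u\<close> that is at most
  \<open>- m\<close>, and this one lacks a dominating term in \<open>u\<close>.\<close>

lemma tropical_nonneg_left_add:
  fixes u v A :: "'e::finite \<Rightarrow> real"
  assumes u: "tropical_nonneg (\<lambda>i. A i * u i)" and v: "tropical_nonneg (\<lambda>i. A i * v i)"
  shows "tropical_nonneg (\<lambda>i. A i * left_add (u i) (v i))"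
proof (rule ccontr)
  define w where "w = (\<lambda>i. left_add (u i) (v i))"
  assume "\<not> ?thesis"
  then obtain i0 where i0: "\<And>k. A k * w k < - (A i0 * w i0)" unfolding not_tropical_nonneg w_def by blast
  obtain i where imin: "\<And>k. A i * w i \<le> A k * w k"
    using ex_is_arg_min_if_finite[of UNIV "\<lambda>i. A i * w i"] unfolding is_arg_min_linorder by auto
  define m where "m = - (A i * w i)"
  have up: "A k * w k < m" for k using i0[of k] imin[of i0] unfolding m_def by linarith
  have abs: "\<bar>A k * w k\<bar> \<le> m" for k using up[of k] imin[of k] unfolding m_def by linarith
  have m0: "0 < m" using up[of i] unfolding m_def by linarith
  have no_u: "A k * u k < m" for k
  proof (rule ccontr)
    assume "\<not> A k * u k < m"
    then have uk: "m \<le> A k * u k" by simp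
    then have neq: "w k \<noteq> u k" using up[of k] by auto
    then have "w k = v k" "\<bar>u k\<bar> < \<bar>v k\<bar>" by (auto simp: w_def left_add_def split: if_splits)
    moreover have "0 < \<bar>A k\<bar>" using uk m0 by auto
    ultimately have "\<bar>A k * u k\<bar> < \<bar>A k * w k\<bar>" unfolding abs_mult by (intro mult_strict_left_mono) auto
    then show False using abs[of k] uk by linarith
  qed
  have "w i \<noteq> u i" using tropical_nonnegD[OF u, of i] no_u by (metis linorder_not_le m_def)
  then have "w i = v i" by (auto simp: w_def left_add_def split: if_splits)
  then obtain k where k: "m \<le> A k * v k" using tropical_nonnegD[OF v, of i] by (auto simp: m_def)
  then have "w k \<noteq> v k" using up[of k] by auto
  then have w: "w k = u k" "\<bar>v k\<bar> \<le> \<bar>u k\<bar>" by (auto simp: w_def left_add_def split: if_splits)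
  have "\<bar>A k * v k\<bar> \<le> \<bar>A k * u k\<bar>" unfolding abs_mult using w(2) by (intro mult_left_mono) auto
  then have "A k * u k \<le> - m" using k up[of k] w(1) by auto
  then obtain l where "m \<le> A l * u l" using tropical_nonnegD[OF u, of k] by (smt (verit))
  then show False using no_u[of l] by simp
qed

definition cone_over :: "(symtrop ^ 'd) set \<Rightarrow> ('d option \<Rightarrow> real) set" where
  "cone_over H = {w. \<exists>c>0. \<exists>x\<in>H. w = (\<lambda>i. c * homogenize x i)}"

lemma homogenize_inj:
  fixes x y :: "symtrop ^ 'd"
  assumes "x \<in> T_space" "y \<in> T_space" "homogenize x = homogenize y" shows "x = y"
proof -
  have "enc (x $ i) = enc (y $ i)" for i using fun_cong[OF assms(3), of "Some i"] by (simp add: homogenize_def)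
  then have "x $ i = y $ i" for i using assms(1,2) dec_enc unfolding T_space_def by (metis mem_Collect_eq)
  then show ?thesis by (simp add: vec_eq_iff)
qed

lemma dehomogenize:
  fixes w :: "'d::finite option \<Rightarrow> real"
  assumes "0 < w None"
  obtains z :: "symtrop ^ 'd" where "z \<in> T_space" "w = (\<lambda>i. w None * homogenize z i)"
proof
  show "(\<chi> i. dec (w (Some i) / w None)) \<in> T_space" by (simp add: T_space_def)
  show "w = (\<lambda>i. w None * homogenize (\<chi> i. dec (w (Some i) / w None)) i)"
    using assms by (auto simp: fun_eq_iff homogenize_def split: option.split)
qed

text \<open>Segments are defined by halfspaces, so a vector of positive height satisfying every
  inequality shared by \<open>u\<close> and \<open>v\<close> dehomogenizes to a point of the
  segment.\<close>

lemma cone_overI: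
  fixes H :: "(symtrop ^ 'd) set"
  assumes H: "TC_convex H" and u: "u \<in> cone_over H" and v: "v \<in> cone_over H" and w: "0 < w None"
    and cond: "\<And>A. tropical_nonneg (\<lambda>i. A i * u i) \<Longrightarrow> tropical_nonneg (\<lambda>i. A i * v i) \<Longrightarrow> tropical_nonneg (\<lambda>i. A i * w i)"
  shows "w \<in> cone_over H"
proof -
  obtain c x where x: "0 < c" "x \<in> H" "u = (\<lambda>i. c * homogenize x i)" using u by (auto simp: cone_over_def)
  obtain d y where y: "0 < d" "y \<in> H" "v = (\<lambda>i. d * homogenize y i)" using v by (auto simp: cone_over_def)
  obtain z :: "symtrop ^ 'd" where z: "z \<in> T_space" "w = (\<lambda>i. w None * homogenize z i)"
    using dehomogenize[of w, OF w] by blast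
  have scale: "tropical_nonneg (\<lambda>i. A i * (c * h i)) \<longleftrightarrow> tropical_nonneg (\<lambda>i. A i * h i)" if "0 < c" for A h and c :: real
    using tropical_nonneg_scale[OF that, of A h] by (simp add: ac_simps)
  have "z \<in> conv_TC x y" unfolding conv_TC_iff
  proof (intro allI impI)
    fix A assume "x \<in> halfspace_of A" "y \<in> halfspace_of A"
    then have "tropical_nonneg (\<lambda>i. A i * w i)"
      by (intro cond) (simp_all add: x(3) y(3) scale x(1) y(1) halfspace_of_def)
    then have "tropical_nonneg (\<lambda>i. A i * (w None * homogenize z i))" using z(2) by metis
    then have "tropical_nonneg (\<lambda>i. A i * homogenize z i)" using scale[OF w, of A "homogenize z"] by blast
    then show "z \<in> halfspace_of A" using z(1) by (simp add: halfspace_of_def)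
  qed
  then have "z \<in> H" using H x(2) y(2) by (auto simp: TC_convex_def)
  then show ?thesis using z(2) w by (auto simp: cone_over_def)
qed

lemma cone_over_None: "u \<in> cone_over H \<Longrightarrow> 0 < u None"
  by (auto simp: cone_over_def homogenize_def)

lemma left_cone_cone_over: assumes "TC_convex H" shows "left_cone (cone_over H)"
  unfolding left_cone_def
proof (intro conjI ballI allI impI)
  fix u and c :: real assume "u \<in> cone_over H" "0 < c"
  then obtain d x where "0 < d" "x \<in> H" "u = (\<lambda>i. d * homogenize x i)" by (auto simp: cone_over_def)
  then show "(\<lambda>i. c * u i) \<in> cone_over H" using \<open>0 < c\<close>
    by (auto simp: cone_over_def mult.assoc[symmetric] intro!: exI[of _ "c * d"])
next
  fix u v assume uv: "u \<in> cone_over H" "v \<in> cone_over H"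
  show "(\<lambda>i. left_add (u i) (v i)) \<in> cone_over H"
    by (rule cone_overI[OF assms uv]) (use uv[THEN cone_over_None] tropical_nonneg_left_add in \<open>auto simp: left_add_def\<close>)
qed

lemma elim_closed_cone_over: assumes "TC_convex H" shows "elim_closed (cone_over H)"
  unfolding elim_closed_def
proof (intro ballI allI impI)
  fix u v b assume uv: "u \<in> cone_over H" "v \<in> cone_over H" and b: "u b \<noteq> 0" "v b = - u b"
    and nc: "\<forall>c. c \<noteq> b \<longrightarrow> u c \<noteq> 0 \<longrightarrow> v c \<noteq> - u c"
  \<comment> \<open>The coordinate \<open>None\<close> is positive throughout the cone and never
    cancels.\<close>
  have "b \<noteq> None"
  proof
    assume "b = None"
    then show False using uv[THEN cone_over_None] b(2) by simp
  qed
  then show "(\<lambda>i. left_add (u i) (v i))(b := 0) \<in> cone_over H"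
    by (intro cone_overI[OF assms uv] tropical_nonneg_elim nc b(2)) (use uv[THEN cone_over_None] in \<open>auto simp: left_add_def\<close>)
qed

text \<open>
  \<open>F\<close> must be nonempty: otherwise the separating \<open>A\<close> could be constant.
\<close>

lemma halfspace_separation:
  fixes H F :: "(symtrop ^ 'd) set"
  assumes H: "TC_convex H" and F: "finite F" "F \<subseteq> H" "F \<noteq> {}" and x: "x \<in> T_space" "x \<notin> H"
  shows "\<exists>A. (\<exists>i. A (Some i) \<noteq> 0) \<and> F \<subseteq> halfspace_of A \<and> x \<notin> halfspace_of A"
proof -
  have HT: "H \<subseteq> T_space" using H by (simp add: TC_convex_def)
  have "homogenize x \<notin> cone_over H"
  proof
    assume "homogenize x \<in> cone_over H"
    then obtain c y where y: "y \<in> H" "homogenize x = (\<lambda>i. c * homogenize y i)" by (auto simp: cone_over_def)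
    then have "homogenize x None = c * homogenize y None" by simp
    then have "c = 1" by (simp add: homogenize_def)
    then show False using homogenize_inj[of x y] x y HT by auto
  qed
  moreover have "homogenize ` F \<subseteq> cone_over H"
    using F(2) by (auto simp: cone_over_def intro!: exI[of _ 1])
  moreover have "homogenize x None \<noteq> 0" by (simp add: homogenize_def)
  ultimately obtain A where A: "\<forall>f\<in>F. tropical_nonneg (\<lambda>i. A i * homogenize f i)" "\<not> tropical_nonneg (\<lambda>i. A i * homogenize x i)"
    using separation_cone[OF left_cone_cone_over[OF H] elim_closed_cone_over[OF H], of "homogenize ` F" "homogenize x" None] F(1)
    by auto
  have "\<exists>i. A (Some i) \<noteq> 0"
  proof (rule ccontr)
    assume "\<not> ?thesis"
    then have z: "A i = 0" if "i \<noteq> None" for i using that by (cases i) auto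
    obtain f where f: "f \<in> F" using F(3) by blast
    have eq: "(\<lambda>i. A i * homogenize f i) = (\<lambda>i. A i * homogenize x i)"
    proof
      fix i show "A i * homogenize f i = A i * homogenize x i" using z[of i] by (cases "i = None") (auto simp: homogenize_def)
    qed
    have "tropical_nonneg (\<lambda>i. A i * homogenize f i)" using A(1) f by blast
    then show False using A(2) unfolding eq by blast
  qed
  then show ?thesis using A F(2) HT by (intro exI[of _ A]) (auto simp: halfspace_of_def)
qed


section \<open>Hemispaces\<close>

lemma \<U>_bounds:
  assumes "q \<in> \<U> s" shows "q \<in> T_pm" "rnorm q \<le> rnorm s" "s \<notin> T_bal \<Longrightarrow> q = s"
proof -
  have "q \<in> T_pm \<and> rnorm q \<le> rnorm s"
  proof (cases "s \<in> T_bal")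
    case False
    then have "q = s" using assms by (simp add: \<U>_def)
    moreover have "s \<in> T_pm"
    proof (cases s)
      case (Elt t r) then show ?thesis using False by (cases t) (auto simp: T_defs)
    qed (simp add: T_defs)
    ultimately show ?thesis by simp
  next
    case True
    then have q: "q \<in> T_pm" "tle (tneg (tnorm s)) q" "tle q (tnorm s)" using assms by (auto simp: \<U>_def)
    show ?thesis
      using True q by (cases s) (auto simp: T_defs tle_def tless_def split: if_splits)
  qed
  then show "q \<in> T_pm" "rnorm q \<le> rnorm s" by auto
  show "q = s" if "s \<notin> T_bal" using assms that by (simp add: \<U>_def)
qed

text \<open>A tropical combination of negative values is negative, so the form is negative at
  \<open>s\<close>. Its negative terms involve only unbalanced entries, which \<open>q\<close>
  shares with \<open>s\<close>, and the remaining terms do not grow in norm.\<close>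

lemma conv_TO_open:
  fixes T :: "(symtrop ^ 'd) set"
  assumes T: "finite T" "T \<subseteq> T_space" and out: "\<And>p. p \<in> T \<Longrightarrow> p \<notin> halfspace_of A" and q: "q \<in> conv_TO T"
  shows "q \<in> T_space" "q \<notin> halfspace_of A"
proof -
  obtain l where l: "\<forall>v\<in>T. l v \<in> T_nonneg" "(\<Sum>v\<in>T. l v) = 1" and qs: "q \<in> \<U>_vec (\<Sum>v\<in>T. l v *s v)"
    using q unfolding conv_TO_def by blast
  define s where "s = (\<Sum>v\<in>T. l v *s v)"
  have q': "q $ i \<in> \<U> (s $ i)" for i using qs by (auto simp: \<U>_vec_def s_def)
  show qT: "q \<in> T_space" using \<U>_bounds(1)[OF q'] by (simp add: T_space_def)
  define a0 a where "a0 = dec (A None)" and "a = (\<chi> i. dec (A (Some i)))"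
  have a: "a0 \<in> T_pm" "a \<in> T_space" by (auto simp: a0_def a_def T_space_def)
  have halfspace_of: "h \<in> halfspace_of A \<longleftrightarrow> (\<Sum>i\<in>UNIV. aff_term a0 a h i) \<notin> T_neg" if "h \<in> T_space" for h
    using that closed_halfspace_dec[of A] unfolding closed_halfspace_def a0_def a_def sum_aff_term not_neg_iff
    by blast
  have s_i: "s $ i = (\<Sum>v\<in>T. l v * v $ i)" for i by (simp add: s_def)
  have "(\<Sum>i\<in>UNIV. a $ i * s $ i) = (\<Sum>v\<in>T. l v * (\<Sum>i\<in>UNIV. a $ i * v $ i))"
  proof -
    have "(\<Sum>i\<in>UNIV. a $ i * s $ i) = (\<Sum>i\<in>UNIV. \<Sum>v\<in>T. l v * (a $ i * v $ i))"
      by (simp add: s_i sum_distrib_left mult.left_commute)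
    also have "\<dots> = (\<Sum>v\<in>T. \<Sum>i\<in>UNIV. l v * (a $ i * v $ i))" by (rule sum.swap)
    finally show ?thesis by (simp add: sum_distrib_left)
  qed
  \<comment> \<open>Since the weights sum to the unit, the constant coefficient is distributed over
    the points as well.\<close>
  moreover have "a0 = (\<Sum>v\<in>T. l v * a0)" using l(2) by (simp add: sum_distrib_right[symmetric])
  ultimately have "(\<Sum>i\<in>UNIV. aff_term a0 a s i) = (\<Sum>v\<in>T. l v * a0) + (\<Sum>v\<in>T. l v * (\<Sum>i\<in>UNIV. a $ i * v $ i))"
    unfolding sum_aff_term[symmetric] by simp
  also have "\<dots> = (\<Sum>v\<in>T. l v * (\<Sum>i\<in>UNIV. aff_term a0 a v i))"
    unfolding sum_aff_term[symmetric] by (simp add: sum.distrib[symmetric] distrib_left)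
  finally have comb: "(\<Sum>i\<in>UNIV. aff_term a0 a s i) = (\<Sum>v\<in>T. l v * (\<Sum>i\<in>UNIV. aff_term a0 a v i))" .
  define c where "c = (\<lambda>v. \<Sum>i\<in>UNIV. aff_term a0 a v i)"
  have cneg: "c v \<in> T_neg" if "v \<in> T" for v using halfspace_of[of v] out[OF that] T(2) that by (auto simp: c_def)
  have lc: "l v * c v \<in> T_neg \<or> l v = 0" if "v \<in> T" for v
    using cneg[OF that] l(1) that by (auto simp: T_nonneg_def T_defs)
  have lc0: "l v * c v \<in> T_neg \<or> rnorm (l v * c v) = 0" if "v \<in> T" for v
    using lc[OF that] by (auto simp: zero_symtrop_def)
  have "\<exists>v\<in>T. l v \<noteq> 0"
  proof (rule ccontr)
    assume "\<not> ?thesis"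
    then have "(\<Sum>v\<in>T. l v) = 0" by (intro sum.neutral) blast
    then show False using l(2) by simp
  qed
  then obtain v where v: "v \<in> T" "l v \<noteq> 0" by blast
  have vneg: "l v * c v \<in> T_neg" using lc v by blast
  have "(\<Sum>v\<in>T. l v * c v) \<in> T_neg"
  proof (rule sum_negI[of T v "\<lambda>v. l v * c v", OF T(1) v(1) vneg])
    fix k assume "k \<in> T"
    then show "l k * c k \<in> T_neg \<or> rnorm (l k * c k) < rnorm (l v * c v)"
      using lc0[of k] rnorm_neg[OF vneg] by auto
  qed
  then have "(\<Sum>i\<in>UNIV. aff_term a0 a s i) \<in> T_neg" by (simp add: comb c_def)
  then obtain i where i: "aff_term a0 a s i \<in> T_neg"
    "\<And>k. aff_term a0 a s k \<in> T_neg \<or> rnorm (aff_term a0 a s k) < rnorm (aff_term a0 a s i)"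
    unfolding sum_neg_iff[OF finite] by blast
  have same: "aff_term a0 a q k = aff_term a0 a s k" if "aff_term a0 a s k \<in> T_neg" for k
  proof (cases k)
    case (Some j)
    have "s $ j \<notin> T_bal"
    proof
      assume "s $ j \<in> T_bal"
      then have "a $ j * s $ j \<in> T_bal"
        by (cases "a $ j") (auto simp: T_defs tsign_mult_commute[of _ Bullet])
      then show False using that Some not_neg_iff by (auto simp: aff_term_def)
    qed
    then show ?thesis using \<U>_bounds(3)[OF q'[of j]] Some by (simp add: aff_term_def)
  qed (simp add: aff_term_def)
  have le: "rnorm (aff_term a0 a q k) \<le> rnorm (aff_term a0 a s k)" for k
    using \<U>_bounds(2)[OF q'] by (cases k) (auto simp: aff_term_def rnorm_mult rnorm_nonneg intro: mult_left_mono)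
  have "(\<Sum>i\<in>UNIV. aff_term a0 a q i) \<in> T_neg"
  proof (rule sum_negI[of _ i])
    show "aff_term a0 a q i \<in> T_neg" using same i(1) by simp
    show "aff_term a0 a q k \<in> T_neg \<or> rnorm (aff_term a0 a q k) < rnorm (aff_term a0 a q i)" for k
      using i(2)[of k] same[of k] same[OF i(1)] le[of k] by (metis order_le_less_trans)
  qed auto
  then show "q \<notin> halfspace_of A" using halfspace_of[OF qT] by simp
qed

text \<open>
  Otherwise the reflected halfspace, tilted slightly by \<open>\<theta>\<close> and \<open>\<eta>\<close>, still contains \<open>p1\<close> and \<open>p2\<close>
  but no longer \<open>q\<close>.
\<close>

lemma conv_TC_open:
  fixes p1 p2 q :: "symtrop ^ 'd"
  assumes A: "A (Some i0) \<noteq> 0" and p: "p1 \<in> T_space" "p2 \<in> T_space" "p1 \<notin> halfspace_of A" "p2 \<notin> halfspace_of A"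
    and q: "q \<in> conv_TC p1 p2"
  shows "q \<notin> halfspace_of A"
proof
  assume "q \<in> halfspace_of A"
  then have tq: "tropical_nonneg (\<lambda>i. A i * homogenize q i)" by (simp add: halfspace_of_def)
  obtain j1 where j1: "\<And>k. A k * homogenize p1 k < - (A j1 * homogenize p1 j1)" 
    using p(1,3) not_tropical_nonneg[of "\<lambda>i. A i * homogenize p1 i"] by (auto simp: halfspace_of_def)
  obtain j2 where j2: "\<And>k. A k * homogenize p2 k < - (A j2 * homogenize p2 j2)" 
    using p(2,4) not_tropical_nonneg[of "\<lambda>i. A i * homogenize p2 i"] by (auto simp: halfspace_of_def)
  define m1 m2 where "m1 = - (A j1 * homogenize p1 j1)" and "m2 = - (A j2 * homogenize p2 j2)"
  have m: "0 < m1" "0 < m2" using j1[of j1] j2[of j2] by (auto simp: m1_def m2_def)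
  \<comment> \<open>The largest ratio of a term to the violating one, at \<open>p1\<close> or
    \<open>p2\<close>; it is below 1 because violations are strict. The \<open>1/2\<close> keeps it
    positive.\<close>
  define \<theta> where "\<theta> = Max (insert (1/2) (range (\<lambda>k. max (A k * homogenize p1 k / m1) (A k * homogenize p2 k / m2))))"
  have "A k * homogenize p1 k / m1 < 1" "A k * homogenize p2 k / m2 < 1" for k
    using j1[of k, folded m1_def] j2[of k, folded m2_def] m by simp_all
  then have "\<theta> < 1" unfolding \<theta>_def by (subst Max_less_iff) auto
  have "1/2 \<le> \<theta>" unfolding \<theta>_def by (rule Max_ge) auto
  then have t0: "0 < \<theta>" by simp
  have le: "A k * homogenize p1 k \<le> \<theta> * m1" "A k * homogenize p2 k \<le> \<theta> * m2" for k
  proof -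
    have "max (A k * homogenize p1 k / m1) (A k * homogenize p2 k / m2) \<le> \<theta>" unfolding \<theta>_def by (rule Max_ge) auto
    then show "A k * homogenize p1 k \<le> \<theta> * m1" "A k * homogenize p2 k \<le> \<theta> * m2" using m by (auto simp: pos_divide_le_eq)
  qed
  define \<eta> where "\<eta> = \<theta> * min m1 m2"
  have e0: "0 < \<eta>" "\<eta> \<le> \<theta> * m1" "\<eta> \<le> \<theta> * m2" using t0 m by (auto simp: \<eta>_def)
  \<comment> \<open>Terms negative at \<open>q\<close> would become positive after reflection, so
    they are shrunk by \<theta>, whereas the largest term at \<open>q\<close> is reflected in full.
    The entry \<open>- \<eta>\<close> handles the case that all terms of \<open>A\<close> vanish at
    \<open>q\<close>.\<close>
  define B where "B = (\<lambda>i. if i = None \<and> A i = 0 then - \<eta>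
      else if A i * homogenize q i < 0 then - (\<theta> * A i) else - A i)"
  have B_eta: "B k = - \<eta>" if "k = None \<and> A k = 0" for k
    unfolding B_def by (rule if_P[OF that])
  have B_small: "B k = - (\<theta> * A k)" if "\<not> (k = None \<and> A k = 0)" "A k * homogenize q k < 0" for k
    unfolding B_def if_not_P[OF that(1)] by (rule if_P[OF that(2)])
  have B_full: "B k = - A k" if "\<not> (k = None \<and> A k = 0)" "\<not> A k * homogenize q k < 0" for k
    unfolding B_def if_not_P[OF that(1)] by (rule if_not_P[OF that(2)])
  \<comment> \<open>After reflection the violating term at \<open>j\<close> is still at least
    \<theta> times \<open>m\<close>, and no negative term exceeds this in absolute value.\<close>
  have Bp: "p \<in> halfspace_of B" if p: "p \<in> T_space" and mp: "0 < m" and mj: "m = - (A j * homogenize p j)"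
    and bound: "\<And>k. A k * homogenize p k \<le> \<theta> * m" and em: "\<eta> \<le> \<theta> * m" for p j m
    unfolding halfspace_of_def mem_Collect_eq
  proof (intro conjI tropical_nonnegI p)
    fix k
    assume neg: "B k * homogenize p k < 0"
    have "- (B k * homogenize p k) \<le> \<theta> * m"
    proof (cases "k = None \<and> A k = 0")
      case True
      then have "homogenize p k = 1" by (simp add: homogenize_def)
      then show ?thesis using em B_eta[OF True] by simp
    next
      case nz: False
      show ?thesis
      proof (cases "A k * homogenize q k < 0")
        case True
        have Bk: "- (B k * homogenize p k) = \<theta> * (A k * homogenize p k)" unfolding B_small[OF nz True] by simp
        have "0 < \<theta> * (A k * homogenize p k)" using neg Bk by linarith
        then have "0 < A k * homogenize p k" using t0 zero_less_mult_pos by blast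
        then have "\<theta> * (A k * homogenize p k) \<le> 1 * (A k * homogenize p k)"
          using \<open>\<theta> < 1\<close> by (intro mult_right_mono) auto
        then show ?thesis using Bk bound[of k] by linarith
      next
        case False
        have "- (B k * homogenize p k) = A k * homogenize p k" unfolding B_full[OF nz False] by simp
        then show ?thesis using bound[of k] by linarith
      qed
    qed
    also have "\<theta> * m \<le> B j * homogenize p j"
    proof -
      have Aj: "\<not> (j = None \<and> A j = 0)" using mp mj by auto
      show ?thesis
      proof (cases "A j * homogenize q j < 0")
        case True
        show ?thesis unfolding B_small[OF Aj True] mj by simp
      next
        case False
        have "\<theta> * m \<le> 1 * m" using \<open>\<theta> < 1\<close> mp by (intro mult_right_mono) auto
        then show ?thesis unfolding B_full[OF Aj False] mj by simp
      qed
    qed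
    finally show "\<exists>l. - (B k * homogenize p k) \<le> B l * homogenize p l" by blast
  qed
  have "p1 \<in> halfspace_of B" by (rule Bp[OF p(1) m(1) m1_def le(1) e0(2)])
  moreover have "p2 \<in> halfspace_of B" by (rule Bp[OF p(2) m(2) m2_def le(2) e0(3)])
  moreover have "B (Some i0) \<noteq> 0" using A t0 by (simp add: B_def)
  ultimately have "q \<in> halfspace_of B" using q unfolding conv_TC_iff by blast
  then have tB: "tropical_nonneg (\<lambda>i. B i * homogenize q i)" by (simp add: halfspace_of_def)
  obtain i where imax: "\<And>k. A k * homogenize q k \<le> A i * homogenize q i"
    using ex_is_arg_min_if_finite[of UNIV "\<lambda>i. - (A i * homogenize q i)"] unfolding is_arg_min_linorder by auto
  define m where "m = A i * homogenize q i"
  have abs: "\<bar>A k * homogenize q k\<bar> \<le> m" for k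
  proof -
    obtain l where "- (A k * homogenize q k) \<le> A l * homogenize q l" using tropical_nonnegD[OF tq, of k] by blast
    then show ?thesis using imax[of l] imax[of k] by (simp add: m_def)
  qed
  have pos: "B k * homogenize q k \<le> \<theta> * m" for k
  proof (cases "k = None \<and> A k = 0")
    case True
    then have "B k * homogenize q k = - \<eta>" using B_eta[OF True] by (simp add: homogenize_def)
    moreover have "0 \<le> m" using abs[of k] by linarith
    then have "0 \<le> \<theta> * m" using t0 by simp
    ultimately show ?thesis using e0(1) by linarith
  next
    case nz: False
    show ?thesis
    proof (cases "A k * homogenize q k < 0")
      case True
      have "B k * homogenize q k = \<theta> * \<bar>A k * homogenize q k\<bar>" unfolding B_small[OF nz True] using True by simp
      also have "\<dots> \<le> \<theta> * m" using abs[of k] t0 by (intro mult_left_mono) auto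
      finally show ?thesis .
    next
      case False
      have "B k * homogenize q k = - (A k * homogenize q k)" unfolding B_full[OF nz False] by simp
      moreover have "0 \<le> m" using abs[of k] by linarith
      then have "0 \<le> \<theta> * m" using t0 by simp
      ultimately show ?thesis using False by linarith
    qed
  qed
  show False
  proof (cases "m = 0")
    case True
    then have AN: "A None = 0" using abs[of None] by (simp add: homogenize_def)
    have "- (B None * homogenize q None) = \<eta>" using B_eta[of None] AN by (simp add: homogenize_def)
    moreover obtain k where "- (B None * homogenize q None) \<le> B k * homogenize q k" using tropical_nonnegD[OF tB, of None] by blast
    ultimately have "\<eta> \<le> \<theta> * m" using pos[of k] by linarith
    then show False using True e0(1) by simp
  next
    case False
    then have mp: "0 < m" using abs[of i] by linarith
    have "A i \<noteq> 0" using mp by (auto simp: m_def)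
    then have "B i * homogenize q i = - m" using mp B_full[of i] by (simp add: m_def)
    moreover obtain k where "- (B i * homogenize q i) \<le> B k * homogenize q k" using tropical_nonnegD[OF tB, of i] by blast
    ultimately have "m \<le> \<theta> * m" using pos[of k] by linarith
    moreover have "\<theta> * m < 1 * m" using mp \<open>\<theta> < 1\<close> by (intro mult_strict_right_mono)
    ultimately show False by simp
  qed
qed

text \<open>Finiteness of \<open>F\<close> is what later makes \<open>halfspace_separation\<close>
  applicable to the points extracted by maximality.\<close>

definition TC_hull :: "(symtrop ^ 'd) set \<Rightarrow> (symtrop ^ 'd) set" where
  "TC_hull X = {z \<in> T_space. \<exists>F. finite F \<and> F \<subseteq> X \<and>
     (\<forall>A. (\<exists>i. A (Some i) \<noteq> 0) \<longrightarrow> F \<subseteq> halfspace_of A \<longrightarrow> z \<in> halfspace_of A)}"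

lemma TC_hull_superset: "X \<subseteq> T_space \<Longrightarrow> X \<subseteq> TC_hull X"
  unfolding TC_hull_def by (auto intro!: exI[of _ "{_}"])

lemma TC_convex_hull: "TC_convex (TC_hull X)"
  unfolding TC_convex_def
proof (intro conjI ballI subsetI)
  show "x \<in> T_space" if "x \<in> TC_hull X" for x using that by (simp add: TC_hull_def)
  fix x y z assume x: "x \<in> TC_hull X" and y: "y \<in> TC_hull X" and z: "z \<in> conv_TC x y"
  obtain F where F: "finite F" "F \<subseteq> X" "\<And>A. \<exists>i. A (Some i) \<noteq> 0 \<Longrightarrow> F \<subseteq> halfspace_of A \<Longrightarrow> x \<in> halfspace_of A"
    using x by (auto simp: TC_hull_def)
  obtain F' where F': "finite F'" "F' \<subseteq> X" "\<And>A. \<exists>i. A (Some i) \<noteq> 0 \<Longrightarrow> F' \<subseteq> halfspace_of A \<Longrightarrow> y \<in> halfspace_of A"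
    using y by (auto simp: TC_hull_def)
  have "z \<in> T_space" using conv_TC_subset[of x y] x y z by (auto simp: TC_hull_def)
  moreover have "\<forall>A. (\<exists>i. A (Some i) \<noteq> 0) \<longrightarrow> F \<union> F' \<subseteq> halfspace_of A \<longrightarrow> z \<in> halfspace_of A"
    using F(3) F'(3) z unfolding conv_TC_iff by blast
  ultimately show "z \<in> TC_hull X" using F(1,2) F'(1,2) unfolding TC_hull_def
    by (intro CollectI conjI exI[of _ "F \<union> F'"]) auto
qed

text \<open>Zorn's lemma applies because TC-convexity concerns two points at a time, and two points
  of the union of a chain lie in a common member.\<close>

lemma maximal_avoiding:
  assumes "TC_convex G" "x \<notin> G"
  obtains H where "TC_convex H" "G \<subseteq> H" "x \<notin> H" "\<And>X. TC_convex X \<Longrightarrow> H \<subseteq> X \<Longrightarrow> x \<notin> X \<Longrightarrow> X = H"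
proof -
  define \<A> where "\<A> = {X. TC_convex X \<and> G \<subseteq> X \<and> x \<notin> X}"
  have "\<exists>M\<in>\<A>. \<forall>X\<in>\<A>. M \<subseteq> X \<longrightarrow> X = M"
  proof (rule subset_Zorn_nonempty)
    show "\<A> \<noteq> {}" using assms by (auto simp: \<A>_def)
    fix \<C> assume ne: "\<C> \<noteq> {}" and ch: "subset.chain \<A> \<C>"
    have sub: "\<C> \<subseteq> \<A>" and lin: "\<And>X Y. X \<in> \<C> \<Longrightarrow> Y \<in> \<C> \<Longrightarrow> X \<subseteq> Y \<or> Y \<subseteq> X"
      using ch by (auto simp: subset_chain_def)
    have "TC_convex (\<Union>\<C>)" unfolding TC_convex_def
    proof (intro conjI ballI)
      show "\<Union>\<C> \<subseteq> T_space" using sub by (auto simp: \<A>_def TC_convex_def)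
      fix y z assume "y \<in> \<Union>\<C>" "z \<in> \<Union>\<C>"
      then obtain Y Z where "Y \<in> \<C>" "Z \<in> \<C>" "y \<in> Y" "z \<in> Z" by blast
      then obtain X where X: "X \<in> \<C>" "y \<in> X" "z \<in> X" using lin[of Y Z] by blast
      then have "TC_convex X" using sub by (auto simp: \<A>_def)
      then have "conv_TC y z \<subseteq> X" using X by (simp add: TC_convex_def)
      then show "conv_TC y z \<subseteq> \<Union>\<C>" using X(1) by blast
    qed
    then show "\<Union>\<C> \<in> \<A>" using ne sub by (auto simp: \<A>_def)
  qed
  then obtain M where M: "M \<in> \<A>" "\<And>X. X \<in> \<A> \<Longrightarrow> M \<subseteq> X \<Longrightarrow> X = M" by blast
  show ?thesis
  proof (rule that)
    show "TC_convex M" "G \<subseteq> M" "x \<notin> M" using M(1) by (auto simp: \<A>_def)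
    show "X = M" if "TC_convex X" "M \<subseteq> X" "x \<notin> X" for X
      by (rule M(2)) (use that M(1) in \<open>auto simp: \<A>_def\<close>)
  qed
qed

lemma separating_hemispace:
  fixes G :: "(symtrop ^ 'd) set"
  assumes G: "TC_convex G" and x: "x \<in> T_space" "x \<notin> G"
  shows "\<exists>H. TC_hemispace H \<and> TO_convex (T_space - H) \<and> G \<subseteq> H \<and> x \<notin> H"
proof -
  obtain H where H: "TC_convex H" "G \<subseteq> H" "x \<notin> H"
    and max: "\<And>X. TC_convex X \<Longrightarrow> H \<subseteq> X \<Longrightarrow> x \<notin> X \<Longrightarrow> X = H"
    using maximal_avoiding[OF G x(2)] by blast
  have HT: "H \<subseteq> T_space" using H(1) by (simp add: TC_convex_def)
  have sep: "\<exists>A. (\<exists>i. A (Some i) \<noteq> 0) \<and> q \<in> halfspace_of A \<and> T \<inter> halfspace_of A = {}"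
    if T: "finite T" "T \<subseteq> T_space - H" and q: "q \<in> H" for T q
  proof -
    have "\<exists>F. finite F \<and> F \<subseteq> insert p H \<and> (\<forall>A. (\<exists>i. A (Some i) \<noteq> 0) \<longrightarrow> F \<subseteq> halfspace_of A \<longrightarrow> x \<in> halfspace_of A)"
      if "p \<in> T" for p
    proof -
      have sub: "insert p H \<subseteq> TC_hull (insert p H)" using HT T that by (intro TC_hull_superset) auto
      \<comment> \<open>The hull is TC-convex and strictly larger than \<open>H\<close>, so by
        maximality it cannot avoid \<open>x\<close>.\<close>
      then have "x \<in> TC_hull (insert p H)" using max[OF TC_convex_hull, of "insert p H"] T that by blast
      then show ?thesis by (simp add: TC_hull_def)
    qed
    then obtain F where F: "\<And>p. p \<in> T \<Longrightarrow> finite (F p) \<and> F p \<subseteq> insert p H \<and>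
        (\<forall>A. (\<exists>i. A (Some i) \<noteq> 0) \<longrightarrow> F p \<subseteq> halfspace_of A \<longrightarrow> x \<in> halfspace_of A)" by metis
    \<comment> \<open>Removing \<open>p\<close> from \<open>F p\<close> leaves points of
      \<open>H\<close>. A halfspace containing \<open>E\<close> and \<open>p\<close> would contain
      \<open>F p\<close>, hence \<open>x\<close>; including \<open>q\<close> makes \<open>E\<close>
      nonempty.\<close>
    define E where "E = insert q (\<Union>p\<in>T. F p - {p})"
    have "finite E" using T(1) F by (auto simp: E_def)
    moreover have "E \<subseteq> H" using q F by (fastforce simp: E_def)
    ultimately obtain A where A: "\<exists>i. A (Some i) \<noteq> 0" "E \<subseteq> halfspace_of A" "x \<notin> halfspace_of A"
      using halfspace_separation[OF H(1) _ _ _ x(1) H(3), of E] by (auto simp: E_def)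
    have "p \<notin> halfspace_of A" if "p \<in> T" for p
    proof
      assume "p \<in> halfspace_of A"
      then have "F p \<subseteq> halfspace_of A" using A(2) that by (auto simp: E_def)
      then show False using F[OF that] A(1,3) by blast
    qed
    then show ?thesis using A by (intro exI[of _ A]) (auto simp: E_def)
  qed
  have "TO_convex (T_space - H)" unfolding TO_convex_def
  proof (intro conjI allI impI subsetI)
    fix T q assume T: "finite T \<and> T \<subseteq> T_space - H" and q: "q \<in> conv_TO T"
    have TT: "T \<subseteq> T_space" "finite T" using T by auto
    have "q \<notin> H"
    proof
      assume "q \<in> H"
      then obtain A where A: "q \<in> halfspace_of A" "T \<inter> halfspace_of A = {}" using sep[of T q] T by blast
      then show False using conv_TO_open(2)[OF TT(2,1) _ q, of A] by blast
    qed
    \<comment> \<open>With constant coefficient \<open>- 1\<close> and no others,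
      \<open>halfspace_of\<close> is empty, so every point of \<open>T\<close> lies outside
      it.\<close>
    moreover have "q \<in> T_space" by (rule conv_TO_open(1)[OF TT(2,1) _ q, of "\<lambda>i. if i = None then - 1 else 0"])
      (auto simp: halfspace_of_def not_tropical_nonneg homogenize_def intro!: exI[of _ None])
    ultimately show "q \<in> T_space - H" by simp
  qed auto
  moreover have "TC_convex (T_space - H)" unfolding TC_convex_def
  proof (intro conjI ballI subsetI)
    fix p1 p2 q assume p: "p1 \<in> T_space - H" "p2 \<in> T_space - H" and q: "q \<in> conv_TC p1 p2"
    have "q \<notin> H"
    proof
      assume "q \<in> H"
      then obtain A i where A: "A (Some i) \<noteq> 0" "q \<in> halfspace_of A" "{p1, p2} \<inter> halfspace_of A = {}"
        using sep[of "{p1, p2}" q] p by auto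
      then show False using conv_TC_open[of A i p1 p2 q, OF A(1) _ _ _ _ q] p by auto
    qed
    then show "q \<in> T_space - H" using conv_TC_subset[of p1 p2] p q by blast
  qed auto
  ultimately show ?thesis using H by (intro exI[of _ H]) (auto simp: TC_hemispace_def)
qed

theorem theorem4p2:
  fixes G :: "(symtrop ^ 'd) set"
  assumes "TC_convex G"
  shows "\<exists>\<F>. (\<forall>H\<in>\<F>. TC_hemispace H \<and> TO_convex (T_space - H)) \<and> G = \<Inter>\<F>"
proof (intro exI conjI)
  let ?F = "{H. TC_hemispace H \<and> TO_convex (T_space - H) \<and> G \<subseteq> H}"
  show "\<forall>H\<in>?F. TC_hemispace H \<and> TO_convex (T_space - H)" by blast
  \<comment> \<open>The family must be nonempty, since otherwise its intersection would be the whole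
    type. It contains \<open>T_space\<close>, whose empty complement is TO-convex because an empty
    sum of weights is never the unit.\<close>
  have "conv_TO {} = ({} :: (symtrop ^ 'd) set)" by (simp add: conv_TO_def)
  then have "(T_space :: (symtrop ^ 'd) set) \<in> ?F"
    using assms conv_TC_subset by (auto simp: TC_hemispace_def TC_convex_def TO_convex_def)
  then show "G = \<Inter>?F"
    using separating_hemispace[OF assms] by blast
qed

end
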